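(* Let $\mathscr A$ be a finitary exact category. Then for any total order $\le$ on the set $\mathrm{Ind}\,\mathscr A$ of isomorphism classes of indecomposable objects of $\mathscr A$, the Hall algebra $H_{\mathscr A}$ is spanned, as a $\mathbb Q$-vector space, by the ordered monomials on $\mathrm{Ind}\,\mathscr A$, i.e. by the products $[X_1][X_2]\cdots[X_k]$ with $k\ge0$, $[X_i]\in\mathrm{Ind}\,\mathscr A$ and $[X_1]\le[X_2]\le\cdots\le[X_k]$. Moreover, if $\mathscr A$ is Krull-Schmidt, then such monomials form a basis of $H_{\mathscr A}$.
   Context: All categories are essentially small; exact categories are in the sense of Quillen. $\mathrm{Iso}\,\mathscr A$ is the set of isomorphism classes $[X]$ of objects, an abelian monoid under $[X]+[Y]=[X\oplus Y]$; $\mathscr A$ is Krull-Schmidt if $\mathrm{Iso}\,\mathscr A$ is freely generated, as an abelian monoid, by $\mathrm{Ind}\,\mathscr A$. $\mathscr A$ is finitary if all Hom sets are finite and for all $A,B$ there are, up to isomorphism, only finitely many $X$ admitting a short exact sequence $B\rightarrowtail X\twoheadrightarrow A$. Let $\mathcal E(A,B)_X$ be the set of all short exact sequences $B\rightarrowtail X\twoheadrightarrow A$ and $F_{A,B}^X=\#\mathcal E(A,B)_X/(\#\mathrm{Aut}\,A\cdot\#\mathrm{Aut}\,B)$. The Hall algebra $H_{\mathscr A}$ is the $\mathbb Q$-vector space with basis $\mathrm{Iso}\,\mathscr A$ and product $[A]\cdot[B]=\sum_{[C]}F_{A,B}^C[C]$; it is associative with unit $[0]$. *)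

theory Defs
  imports
    Complex_Main
    "HOL-Algebra.FiniteProduct"
    "HOL-Library.Multiset"
    "HOL-Library.Poly_Mapping"
begin

section \<open>Categories\<close>

text \<open>
  Small categories, with composition written in the order of functions:
  \<open>g \<cdot> f\<close> is \<open>f\<close> followed by \<open>g\<close>. The laws only concern objects in
  \<open>Obj C\<close> and morphisms in \<open>Arr C\<close>.
\<close>

record ('o, 'm) category_data =
  Obj :: "'o set"
  Arr :: "'m set"
  Dom :: "'m \<Rightarrow> 'o"
  Cod :: "'m \<Rightarrow> 'o"
  Ident :: "'o \<Rightarrow> 'm"
  Comp :: "'m \<Rightarrow> 'm \<Rightarrow> 'm" (infixl \<open>\<cdot>\<index>\<close> 70)

definition Hom :: "('o, 'm, 'x) category_data_scheme \<Rightarrow> 'o \<Rightarrow> 'o \<Rightarrow> 'm set" where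
  "Hom C A B = {f \<in> Arr C. Dom C f = A \<and> Cod C f = B}"

locale category =
  fixes C :: "('o, 'm, 'x) category_data_scheme" (structure)
  assumes dom_cod: "f \<in> Arr C \<Longrightarrow> Dom C f \<in> Obj C \<and> Cod C f \<in> Obj C"
    and ident: "A \<in> Obj C \<Longrightarrow> Ident C A \<in> Hom C A A"
    and comp_closed: "f \<in> Hom C A B \<Longrightarrow> g \<in> Hom C B D \<Longrightarrow> g \<cdot> f \<in> Hom C A D"
    and comp_assoc: "f \<in> Hom C A B \<Longrightarrow> g \<in> Hom C B D \<Longrightarrow> h \<in> Hom C D E \<Longrightarrow>
      h \<cdot> g \<cdot> f = h \<cdot> (g \<cdot> f)"
    and ident_left: "f \<in> Hom C A B \<Longrightarrow> Ident C B \<cdot> f = f"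
    and ident_right: "f \<in> Hom C A B \<Longrightarrow> f \<cdot> Ident C A = f"

definition isomorphisms :: "('o, 'm, 'x) category_data_scheme \<Rightarrow> 'o \<Rightarrow> 'o \<Rightarrow> 'm set" where
  "isomorphisms C A B = {f \<in> Hom C A B. \<exists>g \<in> Hom C B A.
     g \<cdot>\<^bsub>C\<^esub> f = Ident C A \<and> f \<cdot>\<^bsub>C\<^esub> g = Ident C B}"

abbreviation automorphisms :: "('o, 'm, 'x) category_data_scheme \<Rightarrow> 'o \<Rightarrow> 'm set" where
  "automorphisms C A \<equiv> isomorphisms C A A"

definition iso_class :: "('o, 'm, 'x) category_data_scheme \<Rightarrow> 'o \<Rightarrow> 'o set" where
  "iso_class C A = {B \<in> Obj C. isomorphisms C A B \<noteq> {}}"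

definition Iso :: "('o, 'm, 'x) category_data_scheme \<Rightarrow> 'o set set" where
  "Iso C = iso_class C ` Obj C"

definition zero_object :: "('o, 'm, 'x) category_data_scheme \<Rightarrow> 'o \<Rightarrow> bool" where
  "zero_object C Z \<longleftrightarrow> Z \<in> Obj C \<and>
     (\<forall>A \<in> Obj C. (\<exists>!f. f \<in> Hom C A Z) \<and> (\<exists>!f. f \<in> Hom C Z A))"

definition pullback_square ::
    "('o, 'm, 'x) category_data_scheme \<Rightarrow> 'm \<Rightarrow> 'm \<Rightarrow> 'm \<Rightarrow> 'm \<Rightarrow> bool" where
  \<comment> \<open>\<open>p'\<close> is the base change of \<open>p\<close> along \<open>f\<close>, and \<open>f'\<close> is the base change of \<open>f\<close> along \<open>p\<close>\<close>
  "pullback_square C p f p' f' \<longleftrightarrow>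
     (\<exists>X A A' P. p \<in> Hom C X A \<and> f \<in> Hom C A' A \<and> p' \<in> Hom C P A' \<and> f' \<in> Hom C P X \<and>
        p \<cdot>\<^bsub>C\<^esub> f' = f \<cdot>\<^bsub>C\<^esub> p' \<and>
        (\<forall>T g h. g \<in> Hom C T X \<longrightarrow> h \<in> Hom C T A' \<longrightarrow> p \<cdot>\<^bsub>C\<^esub> g = f \<cdot>\<^bsub>C\<^esub> h \<longrightarrow>
           (\<exists>!u. u \<in> Hom C T P \<and> f' \<cdot>\<^bsub>C\<^esub> u = g \<and> p' \<cdot>\<^bsub>C\<^esub> u = h)))"

definition pushout_square ::
    "('o, 'm, 'x) category_data_scheme \<Rightarrow> 'm \<Rightarrow> 'm \<Rightarrow> 'm \<Rightarrow> 'm \<Rightarrow> bool" where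
  \<comment> \<open>\<open>i'\<close> is the cobase change of \<open>i\<close> along \<open>f\<close>, and \<open>f'\<close> is the cobase change of \<open>f\<close> along \<open>i\<close>\<close>
  "pushout_square C i f i' f' \<longleftrightarrow>
     (\<exists>B X B' P. i \<in> Hom C B X \<and> f \<in> Hom C B B' \<and> i' \<in> Hom C B' P \<and> f' \<in> Hom C X P \<and>
        f' \<cdot>\<^bsub>C\<^esub> i = i' \<cdot>\<^bsub>C\<^esub> f \<and>
        (\<forall>T g h. g \<in> Hom C X T \<longrightarrow> h \<in> Hom C B' T \<longrightarrow> g \<cdot>\<^bsub>C\<^esub> i = h \<cdot>\<^bsub>C\<^esub> f \<longrightarrow>
           (\<exists>!u. u \<in> Hom C P T \<and> u \<cdot>\<^bsub>C\<^esub> f' = g \<and> u \<cdot>\<^bsub>C\<^esub> i' = h)))"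


section \<open>Additive categories\<close>

record ('o, 'm) additive_category_data = "('o, 'm) category_data" +
  Add :: "'m \<Rightarrow> 'm \<Rightarrow> 'm" (infixl \<open>\<boxplus>\<index>\<close> 65)
  Zero :: "'o \<Rightarrow> 'o \<Rightarrow> 'm"

definition biproduct :: "('o, 'm, 'x) additive_category_data_scheme \<Rightarrow> 'o \<Rightarrow> 'o \<Rightarrow> 'o \<Rightarrow>
    'm \<Rightarrow> 'm \<Rightarrow> 'm \<Rightarrow> 'm \<Rightarrow> bool" where
  "biproduct C A B S iA iB pA pB \<longleftrightarrow>
     iA \<in> Hom C A S \<and> iB \<in> Hom C B S \<and> pA \<in> Hom C S A \<and> pB \<in> Hom C S B \<and>
     pA \<cdot>\<^bsub>C\<^esub> iA = Ident C A \<and> pB \<cdot>\<^bsub>C\<^esub> iB = Ident C B \<and>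
     pA \<cdot>\<^bsub>C\<^esub> iB = Zero C B A \<and> pB \<cdot>\<^bsub>C\<^esub> iA = Zero C A B \<and>
     iA \<cdot>\<^bsub>C\<^esub> pA \<boxplus>\<^bsub>C\<^esub> iB \<cdot>\<^bsub>C\<^esub> pB = Ident C S"

definition direct_sum :: "('o, 'm, 'x) additive_category_data_scheme \<Rightarrow> 'o \<Rightarrow> 'o \<Rightarrow> 'o \<Rightarrow> bool" where
  "direct_sum C A B S \<longleftrightarrow> A \<in> Obj C \<and> B \<in> Obj C \<and> S \<in> Obj C \<and>
     (\<exists>iA iB pA pB. biproduct C A B S iA iB pA pB)"

locale additive_category = category C
  for C :: "('o, 'm, 'x) additive_category_data_scheme" (structure) +
  assumes hom_group: "A \<in> Obj C \<Longrightarrow> B \<in> Obj C \<Longrightarrow>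
      comm_group \<lparr>carrier = Hom C A B, monoid.mult = Add C, one = Zero C A B\<rparr>"
    and comp_add_left: "f \<in> Hom C A B \<Longrightarrow> f' \<in> Hom C A B \<Longrightarrow> g \<in> Hom C B D \<Longrightarrow>
      g \<cdot> (f \<boxplus> f') = g \<cdot> f \<boxplus> g \<cdot> f'"
    and comp_add_right: "f \<in> Hom C A B \<Longrightarrow> g \<in> Hom C B D \<Longrightarrow> g' \<in> Hom C B D \<Longrightarrow>
      (g \<boxplus> g') \<cdot> f = g \<cdot> f \<boxplus> g' \<cdot> f"
    and zero_object_exists: "\<exists>Z. zero_object C Z"
    and direct_sum_exists: "A \<in> Obj C \<Longrightarrow> B \<in> Obj C \<Longrightarrow> \<exists>S. direct_sum C A B S"

definition is_kernel :: "('o, 'm, 'x) additive_category_data_scheme \<Rightarrow> 'm \<Rightarrow> 'm \<Rightarrow> bool" where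
  "is_kernel C i p \<longleftrightarrow>
     (\<exists>B X A. i \<in> Hom C B X \<and> p \<in> Hom C X A \<and> p \<cdot>\<^bsub>C\<^esub> i = Zero C B A \<and>
        (\<forall>T g. g \<in> Hom C T X \<longrightarrow> p \<cdot>\<^bsub>C\<^esub> g = Zero C T A \<longrightarrow>
           (\<exists>!u. u \<in> Hom C T B \<and> i \<cdot>\<^bsub>C\<^esub> u = g)))"

definition is_cokernel :: "('o, 'm, 'x) additive_category_data_scheme \<Rightarrow> 'm \<Rightarrow> 'm \<Rightarrow> bool" where
  "is_cokernel C p i \<longleftrightarrow>
     (\<exists>B X A. i \<in> Hom C B X \<and> p \<in> Hom C X A \<and> p \<cdot>\<^bsub>C\<^esub> i = Zero C B A \<and>
        (\<forall>T g. g \<in> Hom C X T \<longrightarrow> g \<cdot>\<^bsub>C\<^esub> i = Zero C B T \<longrightarrow>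
           (\<exists>!u. u \<in> Hom C A T \<and> u \<cdot>\<^bsub>C\<^esub> p = g)))"

definition indecomposable :: "('o, 'm, 'x) additive_category_data_scheme \<Rightarrow> 'o \<Rightarrow> bool" where
  "indecomposable C X \<longleftrightarrow> X \<in> Obj C \<and> \<not> zero_object C X \<and>
     (\<forall>A B. direct_sum C A B X \<longrightarrow> zero_object C A \<or> zero_object C B)"

definition Ind :: "('o, 'm, 'x) additive_category_data_scheme \<Rightarrow> 'o set set" where
  "Ind C = iso_class C ` {X. indecomposable C X}"

text \<open>
  The objects that are a direct sum of \<open>X\<close> and \<open>Y\<close> form the isomorphism class \<open>[X \<oplus> Y]\<close>, and
  the zero objects form the class \<open>[0]\<close>.
\<close>

definition Iso_monoid :: "('o, 'm, 'x) additive_category_data_scheme \<Rightarrow> 'o set monoid" where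
  "Iso_monoid C = \<lparr>carrier = Iso C,
     monoid.mult = (\<lambda>P Q. {S. \<exists>X \<in> P. \<exists>Y \<in> Q. direct_sum C X Y S}),
     one = {Z. zero_object C Z}\<rparr>"

text \<open>
  The free abelian monoid on \<open>S\<close> consists of the finite multisets over \<open>S\<close>; the abelian monoid
  \<open>G\<close> is freely generated by \<open>S\<close> if the canonical homomorphism from it to \<open>G\<close> is bijective.
\<close>

definition freely_generated_by :: "('a, 'x) monoid_scheme \<Rightarrow> 'a set \<Rightarrow> bool" where
  "freely_generated_by G S \<longleftrightarrow> S \<subseteq> carrier G \<and>
     bij_betw (\<lambda>M. \<Otimes>\<^bsub>G\<^esub> s \<in> set_mset M. s [^]\<^bsub>G\<^esub> count M s) {M. set_mset M \<subseteq> S} (carrier G)"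

definition Krull_Schmidt :: "('o, 'm, 'x) additive_category_data_scheme \<Rightarrow> bool" where
  "Krull_Schmidt C \<longleftrightarrow> freely_generated_by (Iso_monoid C) (Ind C)"


section \<open>Exact categories\<close>

text \<open>\<open>Ses C\<close> is the class of short exact sequences \<open>B \<rightarrowtail> X \<twoheadrightarrow> A\<close>, as pairs of morphisms.\<close>

record ('o, 'm) exact_category_data = "('o, 'm) additive_category_data" +
  Ses :: "('m \<times> 'm) set"

definition admissible_mono :: "('o, 'm, 'x) exact_category_data_scheme \<Rightarrow> 'm \<Rightarrow> bool" where
  "admissible_mono C i \<longleftrightarrow> (\<exists>p. (i, p) \<in> Ses C)"

definition admissible_epi :: "('o, 'm, 'x) exact_category_data_scheme \<Rightarrow> 'm \<Rightarrow> bool" where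
  "admissible_epi C p \<longleftrightarrow> (\<exists>i. (i, p) \<in> Ses C)"

text \<open>
  Quillen's original axioms. The last two (the ``obscure axiom'') follow from the
  others by a theorem of Keller.
\<close>

locale exact_category = additive_category C
  for C :: "('o, 'm, 'x) exact_category_data_scheme" (structure) +
  assumes kernel_cokernel: "(i, p) \<in> Ses C \<Longrightarrow> is_kernel C i p \<and> is_cokernel C p i"
    and ses_iso: "(i, p) \<in> Ses C \<Longrightarrow> i \<in> Hom C B X \<Longrightarrow> p \<in> Hom C X A \<Longrightarrow>
      i' \<in> Hom C B' X' \<Longrightarrow> p' \<in> Hom C X' A' \<Longrightarrow>
      b \<in> isomorphisms C B B' \<Longrightarrow> x \<in> isomorphisms C X X' \<Longrightarrow> a \<in> isomorphisms C A A' \<Longrightarrow>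
      x \<cdot> i = i' \<cdot> b \<Longrightarrow> a \<cdot> p = p' \<cdot> x \<Longrightarrow> (i', p') \<in> Ses C"
    and split: "biproduct C A B S iA iB pA pB \<Longrightarrow> (iB, pA) \<in> Ses C"
    and epi_comp: "admissible_epi C p \<Longrightarrow> admissible_epi C q \<Longrightarrow>
      p \<in> Hom C X Y \<Longrightarrow> q \<in> Hom C Y Z \<Longrightarrow> admissible_epi C (q \<cdot> p)"
    and mono_comp: "admissible_mono C i \<Longrightarrow> admissible_mono C j \<Longrightarrow>
      i \<in> Hom C X Y \<Longrightarrow> j \<in> Hom C Y Z \<Longrightarrow> admissible_mono C (j \<cdot> i)"
    and epi_base_change: "admissible_epi C p \<Longrightarrow> p \<in> Hom C X A \<Longrightarrow> f \<in> Hom C A' A \<Longrightarrow>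
      \<exists>p' f'. pullback_square C p f p' f' \<and> admissible_epi C p'"
    and mono_cobase_change: "admissible_mono C i \<Longrightarrow> i \<in> Hom C B X \<Longrightarrow> f \<in> Hom C B B' \<Longrightarrow>
      \<exists>i' f'. pushout_square C i f i' f' \<and> admissible_mono C i'"
    and obscure_epi: "p \<in> Hom C X A \<Longrightarrow> \<exists>k. is_kernel C k p \<Longrightarrow>
      e \<in> Hom C N X \<Longrightarrow> admissible_epi C (p \<cdot> e) \<Longrightarrow> admissible_epi C p"
    and obscure_mono: "i \<in> Hom C B X \<Longrightarrow> \<exists>c. is_cokernel C c i \<Longrightarrow>
      e \<in> Hom C X N \<Longrightarrow> admissible_mono C (e \<cdot> i) \<Longrightarrow> admissible_mono C i"

definition short_exact_sequences ::
    "('o, 'm, 'x) exact_category_data_scheme \<Rightarrow> 'o \<Rightarrow> 'o \<Rightarrow> 'o \<Rightarrow> ('m \<times> 'm) set" where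
  \<comment> \<open>the set \<open>\<E>(A, B)\<^sub>X\<close> of short exact sequences \<open>B \<rightarrowtail> X \<twoheadrightarrow> A\<close>\<close>
  "short_exact_sequences C A B X = {(i, p) \<in> Ses C. i \<in> Hom C B X \<and> p \<in> Hom C X A}"

locale finitary_exact_category = exact_category C
  for C :: "('o, 'm, 'x) exact_category_data_scheme" (structure) +
  assumes finite_hom: "A \<in> Obj C \<Longrightarrow> B \<in> Obj C \<Longrightarrow> finite (Hom C A B)"
    and finite_middle_terms: "A \<in> Obj C \<Longrightarrow> B \<in> Obj C \<Longrightarrow>
      finite (iso_class C ` {X. short_exact_sequences C A B X \<noteq> {}})"


section \<open>The Hall algebra\<close>

definition hall_scale :: "rat \<Rightarrow> ('a \<Rightarrow>\<^sub>0 rat) \<Rightarrow> ('a \<Rightarrow>\<^sub>0 rat)" where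
  "hall_scale c u = Poly_Mapping.map ((*) c) u"

lemma lookup_hall_scale [simp]:
  "Poly_Mapping.lookup (hall_scale c u) x = c * Poly_Mapping.lookup u x"
  by (simp add: hall_scale_def Poly_Mapping.map.rep_eq when_def)

global_interpretation hall: vector_space "hall_scale :: rat \<Rightarrow> ('a \<Rightarrow>\<^sub>0 rat) \<Rightarrow> ('a \<Rightarrow>\<^sub>0 rat)"
  by unfold_locales (auto intro!: poly_mapping_eqI simp: lookup_add algebra_simps)

definition hall_algebra :: "('o, 'm, 'x) exact_category_data_scheme \<Rightarrow> ('o set \<Rightarrow>\<^sub>0 rat) set" where
  "hall_algebra C = {u. Poly_Mapping.keys u \<subseteq> Iso C}"

definition hall_number :: "('o, 'm, 'x) exact_category_data_scheme \<Rightarrow> 'o \<Rightarrow> 'o \<Rightarrow> 'o \<Rightarrow> rat" where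
  \<comment> \<open>\<open>F\<close> with subscripts \<open>A\<close>, \<open>B\<close> and superscript \<open>X\<close>\<close>
  "hall_number C A B X =
     of_nat (card (short_exact_sequences C A B X)) /
     (of_nat (card (automorphisms C A)) * of_nat (card (automorphisms C B)))"

text \<open>
  \<open>F\<close> depends on the three objects only through their isomorphism classes, so that it can be
  evaluated at arbitrary representatives. In a finitary category the structure
  constants of each product have finite support.
\<close>

definition hall_coeff ::
    "('o, 'm, 'x) exact_category_data_scheme \<Rightarrow> 'o set \<Rightarrow> 'o set \<Rightarrow> 'o set \<Rightarrow> rat" where
  "hall_coeff C P Q R = hall_number C (SOME A. A \<in> P) (SOME B. B \<in> Q) (SOME X. X \<in> R)"

definition hall_basis_mult ::
    "('o, 'm, 'x) exact_category_data_scheme \<Rightarrow> 'o set \<Rightarrow> 'o set \<Rightarrow> ('o set \<Rightarrow>\<^sub>0 rat)" where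
  "hall_basis_mult C P Q =
     (\<Sum>R \<in> {R \<in> Iso C. hall_coeff C P Q R \<noteq> 0}. Poly_Mapping.single R (hall_coeff C P Q R))"

definition hall_mult :: "('o, 'm, 'x) exact_category_data_scheme \<Rightarrow>
    ('o set \<Rightarrow>\<^sub>0 rat) \<Rightarrow> ('o set \<Rightarrow>\<^sub>0 rat) \<Rightarrow> ('o set \<Rightarrow>\<^sub>0 rat)" where
  "hall_mult C u v = (\<Sum>P \<in> Poly_Mapping.keys u. \<Sum>Q \<in> Poly_Mapping.keys v.
     hall_scale (Poly_Mapping.lookup u P * Poly_Mapping.lookup v Q) (hall_basis_mult C P Q))"

definition hall_unit :: "('o, 'm, 'x) exact_category_data_scheme \<Rightarrow> ('o set \<Rightarrow>\<^sub>0 rat)" where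
  "hall_unit C = Poly_Mapping.single {Z. zero_object C Z} 1"

definition hall_monomial ::
    "('o, 'm, 'x) exact_category_data_scheme \<Rightarrow> 'o set list \<Rightarrow> ('o set \<Rightarrow>\<^sub>0 rat)" where
  \<comment> \<open>the product \<open>[X\<^sub>1] \<cdot> ([X\<^sub>2] \<cdot> (\<dots> ([X\<^sub>k] \<cdot> [0])))\<close>; the Hall algebra is associative with unit \<open>[0]\<close>\<close>
  "hall_monomial C Xs = foldr (\<lambda>X u. hall_mult C (Poly_Mapping.single X 1) u) Xs (hall_unit C)"

definition ordered_words ::
    "('o, 'm, 'x) exact_category_data_scheme \<Rightarrow> 'o set rel \<Rightarrow> 'o set list set" where
  "ordered_words C r = {Xs. set Xs \<subseteq> Ind C \<and> sorted_wrt (\<lambda>X Y. (X, Y) \<in> r) Xs}"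

end

theory Submission
  imports Defs
begin

text \<open>
  For a short exact sequence \<open>B \<rightarrowtail> X \<twoheadrightarrow> A\<close>, left exactness of the Hom functors bounds
  \<open>#Hom(W, X)\<close> and \<open>#Hom(X, W)\<close> by the corresponding numbers for \<open>A \<oplus> B\<close>. If the sequence does
  not split, then \<open>id\<^sub>A\<close> is not in the image of \<open>Hom(A, X) \<rightarrow> Hom(A, A)\<close>, and the bound becomes
  strict: \<open>#End(X) < #End(A \<oplus> B)\<close>. Hence \<open>[X\<^sub>1]\<cdots>[X\<^sub>k]\<close> is a nonzero multiple of
  \<open>[X\<^sub>1 \<oplus> \<cdots> \<oplus> X\<^sub>k]\<close> plus classes that are strictly smaller in this sense. As every object is a
  finite direct sum of indecomposables, induction on \<open>#End\<close> shows that the ordered monomials span.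
  In the Krull-Schmidt case the leading classes of distinct ordered monomials are distinct, and
  independence follows by triangularity.
\<close>

section \<open>The monoid of isomorphism classes\<close>

context category
begin

text \<open>This and the following simp rules recast the category laws with side conditions on
  \<open>Arr\<close>, \<open>Dom\<close> and \<open>Cod\<close> instead of \<open>Hom\<close>, so
  that the simplifier can check composability by itself and nests composites to the right.\<close>

lemma arr_objs [simp]:
  "f \<in> Arr C \<Longrightarrow> Dom C f \<in> Obj C" "f \<in> Arr C \<Longrightarrow> Cod C f \<in> Obj C"
  using dom_cod by auto

lemma ident_arr [simp]:
  assumes "A \<in> Obj C"
  shows "Ident C A \<in> Arr C" "Dom C (Ident C A) = A" "Cod C (Ident C A) = A"
  using ident[OF assms] by (auto simp: Hom_def)

lemma comp_arr [simp]:
  assumes "f \<in> Arr C" "g \<in> Arr C" "Cod C f = Dom C g"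
  shows "g \<cdot> f \<in> Arr C" "Dom C (g \<cdot> f) = Dom C f" "Cod C (g \<cdot> f) = Cod C g"
  using comp_closed[of f "Dom C f" "Dom C g" g "Cod C g"] assms by (auto simp: Hom_def)

lemma arr_assoc [simp]:
  assumes "f \<in> Arr C" "g \<in> Arr C" "h \<in> Arr C" "Cod C f = Dom C g" "Cod C g = Dom C h"
  shows "h \<cdot> g \<cdot> f = h \<cdot> (g \<cdot> f)"
  using comp_assoc[of f "Dom C f" "Dom C g" g "Dom C h" h "Cod C h"] assms by (auto simp: Hom_def)

lemma ident_comp [simp]:
  "f \<in> Arr C \<Longrightarrow> Cod C f = A \<Longrightarrow> Ident C A \<cdot> f = f"
  "f \<in> Arr C \<Longrightarrow> Dom C f = A \<Longrightarrow> f \<cdot> Ident C A = f"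
  using ident_left[of f "Dom C f" A] ident_right[of f A "Cod C f"] by (auto simp: Hom_def)

lemma isomorphisms_ident: "A \<in> Obj C \<Longrightarrow> Ident C A \<in> isomorphisms C A A"
  by (auto simp: isomorphisms_def Hom_def intro!: exI[of _ "Ident C A"])

lemma isomorphisms_sym:
  assumes "isomorphisms C A B \<noteq> {}"
  shows "isomorphisms C B A \<noteq> {}"
  using assms by (auto simp: isomorphisms_def)

lemma isomorphisms_trans:
  assumes "isomorphisms C A B \<noteq> {}" "isomorphisms C B D \<noteq> {}"
  shows "isomorphisms C A D \<noteq> {}"
proof -
  obtain f f' g g' where fg: "f \<in> Hom C A B" "f' \<in> Hom C B A" "f' \<cdot> f = Ident C A" "f \<cdot> f' = Ident C B"
    "g \<in> Hom C B D" "g' \<in> Hom C D B" "g' \<cdot> g = Ident C B" "g \<cdot> g' = Ident C D"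
    using assms by (auto simp: isomorphisms_def)
  have "f' \<cdot> g' \<cdot> (g \<cdot> f) = f' \<cdot> (g' \<cdot> g) \<cdot> f" "g \<cdot> f \<cdot> (f' \<cdot> g') = g \<cdot> (f \<cdot> f') \<cdot> g'"
    using fg(1,2,5,6) by (auto simp: Hom_def)
  with fg have "f' \<cdot> g' \<cdot> (g \<cdot> f) = Ident C A" "g \<cdot> f \<cdot> (f' \<cdot> g') = Ident C D"
    by (auto simp: Hom_def)
  with fg have "g \<cdot> f \<in> isomorphisms C A D"
    by (auto simp: isomorphisms_def Hom_def intro!: exI[of _ "f' \<cdot> g'"])
  then show ?thesis by blast
qed

lemma self_in_iso_class [simp]: "A \<in> Obj C \<Longrightarrow> A \<in> iso_class C A"
  using isomorphisms_ident by (auto simp: iso_class_def)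

lemma iso_class_eq:
  assumes "B \<in> iso_class C A"
  shows "iso_class C B = iso_class C A"
proof -
  have "isomorphisms C A B \<noteq> {}" using assms by (simp add: iso_class_def)
  then show ?thesis
    unfolding iso_class_def using isomorphisms_sym isomorphisms_trans by blast
qed

lemma iso_class_in_Iso [simp]: "A \<in> Obj C \<Longrightarrow> iso_class C A \<in> Iso C"
  by (simp add: Iso_def)

text \<open>Classes in \<open>Iso C\<close> are non-empty, so \<open>SOME\<close> picks a genuine
  representative. This controls the choices made in \<open>hall_coeff\<close> and
  \<open>hom_number\<close>.\<close>

lemma some_rep:
  assumes "P \<in> Iso C"
  shows "(SOME A. A \<in> P) \<in> Obj C" "iso_class C (SOME A. A \<in> P) = P"
proof -
  obtain A where A: "A \<in> Obj C" "P = iso_class C A" using assms by (auto simp: Iso_def)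
  then have "(SOME A. A \<in> P) \<in> P" using self_in_iso_class by (metis someI)
  then show "(SOME A. A \<in> P) \<in> Obj C" "iso_class C (SOME A. A \<in> P) = P"
    using A iso_class_eq by (auto simp: iso_class_def)
qed

lemma Iso_cases:
  assumes "P \<in> Iso C"
  obtains A where "A \<in> Obj C" "P = iso_class C A"
  using assms by (auto simp: Iso_def)

text \<open>Composing with the isomorphisms on both sides maps \<open>Hom C A X\<close> onto
  \<open>Hom C A' X'\<close>. An inequality suffices, as exchanging the roles of the objects gives
  the converse.\<close>

lemma card_Hom_le:
  assumes "finite (Hom C A X)" "A' \<in> iso_class C A" "X' \<in> iso_class C X"
  shows "card (Hom C A' X') \<le> card (Hom C A X)"
proof -
  obtain a a' where a: "a \<in> Hom C A A'" "a' \<in> Hom C A' A" "a \<cdot> a' = Ident C A'"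
    using assms by (auto simp: iso_class_def isomorphisms_def)
  obtain x x' where x: "x \<in> Hom C X X'" "x' \<in> Hom C X' X" "x \<cdot> x' = Ident C X'"
    using assms by (auto simp: iso_class_def isomorphisms_def)
  have "g \<in> (\<lambda>f. x \<cdot> (f \<cdot> a')) ` Hom C A X" if g: "g \<in> Hom C A' X'" for g
  proof
    show "x' \<cdot> (g \<cdot> a) \<in> Hom C A X" using a x g by (auto simp: Hom_def)
    have "x \<cdot> (x' \<cdot> (g \<cdot> a) \<cdot> a') = (x \<cdot> x') \<cdot> (g \<cdot> (a \<cdot> a'))"
      using a(1,2) x(1,2) g by (auto simp: Hom_def)
    then show "g = x \<cdot> (x' \<cdot> (g \<cdot> a) \<cdot> a')" using a x g by (auto simp: Hom_def)
  qed
  then have "Hom C A' X' \<subseteq> (\<lambda>f. x \<cdot> (f \<cdot> a')) ` Hom C A X" by blast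
  then show ?thesis by (rule surj_card_le[OF assms(1)])
qed

end

section \<open>Arithmetic of morphisms in an additive category\<close>

context additive_category
begin

lemma zero_arr [simp]:
  assumes "A \<in> Obj C" "B \<in> Obj C"
  shows "Zero C A B \<in> Arr C" "Dom C (Zero C A B) = A" "Cod C (Zero C A B) = B"
proof -
  interpret G: comm_group "\<lparr>carrier = Hom C A B, monoid.mult = Add C, one = Zero C A B\<rparr>"
    by (rule hom_group[OF assms])
  show "Zero C A B \<in> Arr C" "Dom C (Zero C A B) = A" "Cod C (Zero C A B) = B"
    using G.one_closed by (auto simp: Hom_def)
qed

lemma add_arr [simp]:
  assumes "f \<in> Arr C" "g \<in> Arr C" "Dom C f = Dom C g" "Cod C f = Cod C g"
  shows "f \<boxplus> g \<in> Arr C" "Dom C (f \<boxplus> g) = Dom C g" "Cod C (f \<boxplus> g) = Cod C g"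
proof -
  interpret G: comm_group "\<lparr>carrier = Hom C (Dom C g) (Cod C g), monoid.mult = Add C, one = Zero C (Dom C g) (Cod C g)\<rparr>"
    by (rule hom_group) (use assms in auto)
  show "f \<boxplus> g \<in> Arr C" "Dom C (f \<boxplus> g) = Dom C g" "Cod C (f \<boxplus> g) = Cod C g"
    using G.m_closed[of f g] assms by (auto simp: Hom_def)
qed

lemma add_commute:
  assumes "f \<in> Arr C" "g \<in> Arr C" "Dom C f = Dom C g" "Cod C f = Cod C g"
  shows "f \<boxplus> g = g \<boxplus> f"
proof -
  interpret G: comm_group "\<lparr>carrier = Hom C (Dom C g) (Cod C g), monoid.mult = Add C, one = Zero C (Dom C g) (Cod C g)\<rparr>"
    by (rule hom_group) (use assms in auto)
  show ?thesis using G.m_comm[of f g] assms by (auto simp: Hom_def)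
qed

lemma add_assoc:
  assumes "f \<in> Arr C" "g \<in> Arr C" "h \<in> Arr C" "Dom C f = Dom C g" "Cod C f = Cod C g"
    "Dom C g = Dom C h" "Cod C g = Cod C h"
  shows "f \<boxplus> g \<boxplus> h = f \<boxplus> (g \<boxplus> h)"
proof -
  interpret G: comm_group "\<lparr>carrier = Hom C (Dom C g) (Cod C g), monoid.mult = Add C, one = Zero C (Dom C g) (Cod C g)\<rparr>"
    by (rule hom_group) (use assms in auto)
  show ?thesis using G.m_assoc[of f g h] assms by (auto simp: Hom_def)
qed

lemma add_zero [simp]:
  assumes "f \<in> Arr C" "Dom C f = A" "Cod C f = B"
  shows "f \<boxplus> Zero C A B = f" "Zero C A B \<boxplus> f = f"
proof -
  interpret G: comm_group "\<lparr>carrier = Hom C A B, monoid.mult = Add C, one = Zero C A B\<rparr>"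
    by (rule hom_group) (use assms in auto)
  show "f \<boxplus> Zero C A B = f" "Zero C A B \<boxplus> f = f"
    using G.r_one[of f] G.l_one[of f] assms by (auto simp: Hom_def)
qed

lemma add_inverse:
  assumes "f \<in> Hom C A B"
  obtains n where "n \<in> Hom C A B" "f \<boxplus> n = Zero C A B" "n \<boxplus> f = Zero C A B"
proof -
  interpret G: comm_group "\<lparr>carrier = Hom C A B, monoid.mult = Add C, one = Zero C A B\<rparr>"
    by (rule hom_group) (use assms in \<open>auto simp: Hom_def\<close>)
  show ?thesis
    using that[of "inv\<^bsub>\<lparr>carrier = Hom C A B, monoid.mult = Add C, one = Zero C A B\<rparr>\<^esub> f"]
      G.inv_closed[of f] G.l_inv[of f] G.r_inv[of f] assms by simp
qed

lemma add_idem_zero: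
  assumes "f \<in> Hom C A B" "f \<boxplus> f = f"
  shows "f = Zero C A B"
proof -
  interpret G: comm_group "\<lparr>carrier = Hom C A B, monoid.mult = Add C, one = Zero C A B\<rparr>"
    by (rule hom_group) (use assms in \<open>auto simp: Hom_def\<close>)
  show ?thesis using G.r_cancel_one'[of f f] assms by simp
qed

lemma comp_distrib [simp]:
  "f \<in> Arr C \<Longrightarrow> f' \<in> Arr C \<Longrightarrow> g \<in> Arr C \<Longrightarrow> Dom C f = Dom C f' \<Longrightarrow> Cod C f = Cod C f' \<Longrightarrow>
    Cod C f' = Dom C g \<Longrightarrow> g \<cdot> (f \<boxplus> f') = g \<cdot> f \<boxplus> g \<cdot> f'"
  "g \<in> Arr C \<Longrightarrow> g' \<in> Arr C \<Longrightarrow> f \<in> Arr C \<Longrightarrow> Dom C g = Dom C g' \<Longrightarrow> Cod C g = Cod C g' \<Longrightarrow>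
    Cod C f = Dom C g' \<Longrightarrow> (g \<boxplus> g') \<cdot> f = g \<cdot> f \<boxplus> g' \<cdot> f"
  using comp_add_left[of f "Dom C f'" "Cod C f'" f' g "Cod C g"]
    comp_add_right[of f "Dom C f" "Cod C f" g "Cod C g'" g'] by (auto simp: Hom_def)

text \<open>By distributivity a composite with zero equals its own double, and in a group only the
  neutral element does.\<close>

lemma comp_zero [simp]:
  assumes "f \<in> Arr C" "A \<in> Obj C"
  shows "Dom C f = B \<Longrightarrow> f \<cdot> Zero C A B = Zero C A (Cod C f)"
    "Cod C f = B \<Longrightarrow> Zero C B A \<cdot> f = Zero C (Dom C f) A"
proof -
  assume B: "Dom C f = B"
  have "f \<cdot> Zero C A B \<boxplus> f \<cdot> Zero C A B = f \<cdot> (Zero C A B \<boxplus> Zero C A B)"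
    using assms B by (subst comp_distrib) auto
  also have "\<dots> = f \<cdot> Zero C A B" using assms B by (subst add_zero) auto
  finally show "f \<cdot> Zero C A B = Zero C A (Cod C f)"
    using assms B by (intro add_idem_zero) (auto simp: Hom_def)
next
  assume B: "Cod C f = B"
  have "Zero C B A \<cdot> f \<boxplus> Zero C B A \<cdot> f = (Zero C B A \<boxplus> Zero C B A) \<cdot> f"
    using assms B by (subst comp_distrib) auto
  also have "\<dots> = Zero C B A \<cdot> f" using assms B by (subst add_zero) auto
  finally show "Zero C B A \<cdot> f = Zero C (Dom C f) A"
    using assms B by (intro add_idem_zero) (auto simp: Hom_def)
qed

lemma zero_in_Hom [simp]: "A \<in> Obj C \<Longrightarrow> B \<in> Obj C \<Longrightarrow> Zero C A B \<in> Hom C A B"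
  by (simp add: Hom_def)

text \<open>Every arrow into or out of \<open>Z\<close> is its composite with
  \<open>Ident C Z\<close>, hence zero once the identity is. This gives an equational test for zero
  objects.\<close>

lemma zero_object_iff: "zero_object C Z \<longleftrightarrow> Z \<in> Obj C \<and> Ident C Z = Zero C Z Z"
proof
  assume "zero_object C Z"
  then show "Z \<in> Obj C \<and> Ident C Z = Zero C Z Z"
    unfolding zero_object_def using ident zero_in_Hom by blast
next
  assume Z: "Z \<in> Obj C \<and> Ident C Z = Zero C Z Z"
  have "f = Zero C A Z" if "f \<in> Hom C A Z" for f A
    using that Z ident_comp(1)[of f Z] comp_zero(2)[of f Z Z] by (auto simp: Hom_def)
  moreover have "f = Zero C Z A" if "f \<in> Hom C Z A" for f A
    using that Z ident_comp(2)[of f Z] comp_zero(1)[of f Z Z] by (auto simp: Hom_def)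
  ultimately show "zero_object C Z" unfolding zero_object_def using Z zero_in_Hom by metis
qed

section \<open>Biproducts and the uniqueness of direct sums\<close>

text \<open>The biproduct equations with a further arrow \<open>f\<close> composed on the right,
  which is how they occur inside composites nested to the right.\<close>

lemma biproduct_reassoc:
  assumes "biproduct C A B S iA iB pA pB" "f \<in> Arr C"
  shows "Cod C f = A \<Longrightarrow> pA \<cdot> (iA \<cdot> f) = f" "Cod C f = B \<Longrightarrow> pB \<cdot> (iB \<cdot> f) = f"
    "Cod C f = A \<Longrightarrow> pB \<cdot> (iA \<cdot> f) = Zero C (Dom C f) B"
    "Cod C f = B \<Longrightarrow> pA \<cdot> (iB \<cdot> f) = Zero C (Dom C f) A"
    "Cod C f = S \<Longrightarrow> iA \<cdot> (pA \<cdot> f) \<boxplus> iB \<cdot> (pB \<cdot> f) = f"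
proof -
  have *: "iA \<in> Arr C" "iB \<in> Arr C" "pA \<in> Arr C" "pB \<in> Arr C" "Dom C iA = A" "Dom C iB = B"
    "Dom C pA = S" "Dom C pB = S" "Cod C iA = S" "Cod C iB = S" "Cod C pA = A" "Cod C pB = B"
    and eqs: "pA \<cdot> iA = Ident C A" "pB \<cdot> iB = Ident C B" "pA \<cdot> iB = Zero C B A" "pB \<cdot> iA = Zero C A B"
     "iA \<cdot> pA \<boxplus> iB \<cdot> pB = Ident C S"
    using assms by (auto simp: biproduct_def Hom_def)
  have obj: "A \<in> Obj C" "B \<in> Obj C" "S \<in> Obj C" using * dom_cod by metis+
  show "Cod C f = A \<Longrightarrow> pA \<cdot> (iA \<cdot> f) = f" "Cod C f = B \<Longrightarrow> pB \<cdot> (iB \<cdot> f) = f"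
    "Cod C f = A \<Longrightarrow> pB \<cdot> (iA \<cdot> f) = Zero C (Dom C f) B"
    "Cod C f = B \<Longrightarrow> pA \<cdot> (iB \<cdot> f) = Zero C (Dom C f) A"
    using * eqs obj assms(2) arr_assoc[of f iA pA] arr_assoc[of f iA pB]
      arr_assoc[of f iB pA] arr_assoc[of f iB pB] by (auto simp del: arr_assoc)
  assume f: "Cod C f = S"
  have "iA \<cdot> (pA \<cdot> f) \<boxplus> iB \<cdot> (pB \<cdot> f) = (iA \<cdot> pA \<boxplus> iB \<cdot> pB) \<cdot> f"
    using * assms(2) f by simp
  then show "iA \<cdot> (pA \<cdot> f) \<boxplus> iB \<cdot> (pB \<cdot> f) = f"
    unfolding eqs using assms(2) f by simp
qed

lemma biproductD:
  assumes "biproduct C A B S iA iB pA pB"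
  shows "iA \<in> Arr C" "iB \<in> Arr C" "pA \<in> Arr C" "pB \<in> Arr C" "Dom C iA = A" "Dom C iB = B"
    "Dom C pA = S" "Dom C pB = S" "Cod C iA = S" "Cod C iB = S" "Cod C pA = A" "Cod C pB = B"
    "pA \<cdot> iA = Ident C A" "pB \<cdot> iB = Ident C B" "pA \<cdot> iB = Zero C B A" "pB \<cdot> iA = Zero C A B"
    "iA \<cdot> pA \<boxplus> iB \<cdot> pB = Ident C S" "A \<in> Obj C" "B \<in> Obj C" "S \<in> Obj C"
  using assms dom_cod by (auto simp: biproduct_def Hom_def)

text \<open>The two factors are the diagonal maps induced by \<open>a'\<close>, \<open>b'\<close>
  and by \<open>a\<close>, \<open>b\<close>. One composite is enough: the other follows by swapping
  the two biproducts.\<close>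

lemma biproduct_map_inverse:
  assumes S: "biproduct C A B S iA iB pA pB" and S': "biproduct C A' B' S' iA' iB' pA' pB'"
    and "a \<in> Hom C A A'" "a' \<in> Hom C A' A" "a' \<cdot> a = Ident C A"
    and "b \<in> Hom C B B'" "b' \<in> Hom C B' B" "b' \<cdot> b = Ident C B"
  shows "(iA \<cdot> (a' \<cdot> pA') \<boxplus> iB \<cdot> (b' \<cdot> pB')) \<cdot> (iA' \<cdot> (a \<cdot> pA) \<boxplus> iB' \<cdot> (b \<cdot> pB)) = Ident C S"
proof -
  have ab: "a \<in> Arr C" "a' \<in> Arr C" "Dom C a = A" "Cod C a = A'" "Dom C a' = A'" "Cod C a' = A"
    "b \<in> Arr C" "b' \<in> Arr C" "Dom C b = B" "Cod C b = B'" "Dom C b' = B'" "Cod C b' = B"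
    using assms by (auto simp: Hom_def)
  have r: "a' \<cdot> (a \<cdot> f) = f" if "f \<in> Arr C" "Cod C f = A" for f
    using that ab assms(5) arr_assoc[of f a a'] by (simp del: arr_assoc)
  have r': "b' \<cdot> (b \<cdot> f) = f" if "f \<in> Arr C" "Cod C f = B" for f
    using that ab assms(8) arr_assoc[of f b b'] by (simp del: arr_assoc)
  show ?thesis
    using biproductD[OF S] biproductD[OF S'] ab
    by (simp add: biproduct_reassoc[OF S] biproduct_reassoc[OF S'] r r')
qed

lemma direct_sum_unique:
  assumes "direct_sum C A B S" "direct_sum C A' B' S'" "A' \<in> iso_class C A" "B' \<in> iso_class C B"
  shows "S' \<in> iso_class C S"
proof -
  obtain iA iB pA pB where S: "biproduct C A B S iA iB pA pB"
    using assms by (auto simp: direct_sum_def)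
  obtain iA' iB' pA' pB' where S': "biproduct C A' B' S' iA' iB' pA' pB'"
    using assms by (auto simp: direct_sum_def)
  obtain a a' where a: "a \<in> Hom C A A'" "a' \<in> Hom C A' A" "a \<cdot> a' = Ident C A'" "a' \<cdot> a = Ident C A"
    using assms by (auto simp: iso_class_def isomorphisms_def)
  obtain b b' where b: "b \<in> Hom C B B'" "b' \<in> Hom C B' B" "b \<cdot> b' = Ident C B'" "b' \<cdot> b = Ident C B"
    using assms by (auto simp: iso_class_def isomorphisms_def)
  have "iA' \<cdot> (a \<cdot> pA) \<boxplus> iB' \<cdot> (b \<cdot> pB) \<in> Hom C S S'"
    "iA \<cdot> (a' \<cdot> pA') \<boxplus> iB \<cdot> (b' \<cdot> pB') \<in> Hom C S' S"
    using biproductD[OF S] biproductD[OF S'] a b by (auto simp: Hom_def)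
  with biproduct_map_inverse[OF S S' a(1,2,4) b(1,2,4)]
    biproduct_map_inverse[OF S' S a(2,1,3) b(2,1,3)]
  have "iA' \<cdot> (a \<cdot> pA) \<boxplus> iB' \<cdot> (b \<cdot> pB) \<in> isomorphisms C S S'"
    unfolding isomorphisms_def by blast
  then show ?thesis using assms by (auto simp: iso_class_def direct_sum_def)
qed

text \<open>The structure maps are transported along the isomorphism. Together with
  \<open>direct_sum_unique\<close> this shows that the direct sums of \<open>A\<close> and
  \<open>B\<close> fill exactly one isomorphism class.\<close>

lemma direct_sum_iso_class:
  assumes "direct_sum C A B S" "S' \<in> iso_class C S"
  shows "direct_sum C A B S'"
proof -
  obtain iA iB pA pB where S: "biproduct C A B S iA iB pA pB"
    using assms by (auto simp: direct_sum_def)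
  obtain s s' where s: "s \<in> Hom C S S'" "s' \<in> Hom C S' S" "s \<cdot> s' = Ident C S'" "s' \<cdot> s = Ident C S"
    using assms by (auto simp: iso_class_def isomorphisms_def)
  then have s': "s \<in> Arr C" "s' \<in> Arr C" "Dom C s = S" "Cod C s = S'" "Dom C s' = S'" "Cod C s' = S"
    by (auto simp: Hom_def)
  have r: "s' \<cdot> (s \<cdot> f) = f" if "f \<in> Arr C" "Cod C f = S" for f
    using that s s' arr_assoc[of f s s'] by (simp del: arr_assoc)
  have "s \<cdot> iA \<cdot> (pA \<cdot> s') \<boxplus> s \<cdot> iB \<cdot> (pB \<cdot> s') = s \<cdot> (iA \<cdot> pA \<boxplus> iB \<cdot> pB) \<cdot> s'"
    using biproductD(1-12)[OF S] s' by simp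
  also have "\<dots> = Ident C S'" using biproductD(17)[OF S] s' s by simp
  finally have "biproduct C A B S' (s \<cdot> iA) (s \<cdot> iB) (pA \<cdot> s') (pB \<cdot> s')"
    unfolding biproduct_def using biproductD[OF S] s' by (auto simp: Hom_def r)
  then show ?thesis using assms by (auto simp: direct_sum_def iso_class_def)
qed

lemma direct_sum_commute:
  assumes "direct_sum C A B S"
  shows "direct_sum C B A S"
proof -
  obtain iA iB pA pB where S: "biproduct C A B S iA iB pA pB"
    using assms by (auto simp: direct_sum_def)
  have "biproduct C B A S iB iA pB pA"
    unfolding biproduct_def using biproductD[OF S] add_commute[of "iB \<cdot> pB" "iA \<cdot> pA"]
    by (auto simp: Hom_def)
  then show ?thesis using assms by (auto simp: direct_sum_def)
qed

lemma direct_sum_assoc: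
  assumes "direct_sum C A B S" "direct_sum C S D T" "direct_sum C B D U"
  shows "direct_sum C A U T"
proof -
  obtain iA iB pA pB where S: "biproduct C A B S iA iB pA pB"
    using assms by (auto simp: direct_sum_def)
  obtain iS iD pS pD where T: "biproduct C S D T iS iD pS pD"
    using assms by (auto simp: direct_sum_def)
  obtain jB jD qB qD where U: "biproduct C B D U jB jD qB qD"
    using assms by (auto simp: direct_sum_def)
  note D = biproductD[OF S] biproductD[OF T] biproductD[OF U]
  note R = biproduct_reassoc[OF S] biproduct_reassoc[OF T] biproduct_reassoc[OF U]
  \<comment> \<open>The maps between \<open>U\<close> and \<open>T\<close> are assembled from
    components: \<open>B\<close> passes through \<open>S\<close>, while \<open>D\<close> is a
    summand of \<open>T\<close> directly. Collecting the part that factors through \<open>S\<close>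
    lets the completeness relations of \<open>S\<close> and then of \<open>T\<close> reduce the sum
    to the identity.\<close>
  have "iS \<cdot> iA \<cdot> (pA \<cdot> pS) \<boxplus> (iS \<cdot> iB \<cdot> qB \<boxplus> iD \<cdot> qD) \<cdot> (jB \<cdot> (pB \<cdot> pS) \<boxplus> jD \<cdot> pD)
    = iS \<cdot> (iA \<cdot> (pA \<cdot> pS) \<boxplus> iB \<cdot> (pB \<cdot> pS)) \<boxplus> iD \<cdot> pD"
    using D by (simp add: R(1-4,6-9,11-14) add_assoc)
  also have "\<dots> = Ident C T" using D R(5) by simp
  finally have "biproduct C A U T (iS \<cdot> iA) (iS \<cdot> iB \<cdot> qB \<boxplus> iD \<cdot> qD)
      (pA \<cdot> pS) (jB \<cdot> (pB \<cdot> pS) \<boxplus> jD \<cdot> pD)"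
    unfolding biproduct_def using D by (auto simp: Hom_def R)
  then show ?thesis using assms by (auto simp: direct_sum_def)
qed

lemma direct_sum_zero:
  assumes "zero_object C Z" "X \<in> Obj C"
  shows "direct_sum C Z X X"
proof -
  have "biproduct C Z X X (Zero C Z X) (Ident C X) (Zero C X Z) (Ident C X)"
    using assms by (auto simp: biproduct_def Hom_def zero_object_iff)
  then show ?thesis using assms by (auto simp: direct_sum_def zero_object_iff)
qed

lemma zero_object_class:
  assumes "zero_object C Z"
  shows "{Z. zero_object C Z} = iso_class C Z"
proof (intro equalityI subsetI)
  fix Z' assume "Z' \<in> {Z. zero_object C Z}"
  then have Z': "zero_object C Z'" by simp
  then have "Zero C Z Z' \<in> isomorphisms C Z Z'"
    using assms by (auto simp: isomorphisms_def zero_object_iff intro!: bexI[of _ "Zero C Z' Z"])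
  then show "Z' \<in> iso_class C Z" using Z' by (auto simp: iso_class_def zero_object_iff)
next
  fix Z' assume Z': "Z' \<in> iso_class C Z"
  then obtain s s' where s: "s \<in> Hom C Z Z'" "s' \<in> Hom C Z' Z" "s \<cdot> s' = Ident C Z'"
    by (auto simp: iso_class_def isomorphisms_def)
  have "Ident C Z = Zero C Z Z" using assms by (simp add: zero_object_iff)
  then have "s = Zero C Z Z'"
    using s ident_comp(2)[of s Z] comp_zero(1)[of s Z Z] by (auto simp: Hom_def)
  then have "Ident C Z' = Zero C Z' Z'"
    using s Z' by (auto simp: iso_class_def Hom_def)
  then show "Z' \<in> {Z. zero_object C Z}" using Z' by (auto simp: zero_object_iff iso_class_def)
qed

section \<open>The commutative monoid of isomorphism classes\<close>

lemma carrier_Iso_monoid [simp]: "carrier (Iso_monoid C) = Iso C"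
  by (simp add: Iso_monoid_def)

lemma Iso_mult:
  assumes "direct_sum C A B S"
  shows "iso_class C A \<otimes>\<^bsub>Iso_monoid C\<^esub> iso_class C B = iso_class C S"
proof -
  have "A \<in> Obj C" "B \<in> Obj C" using assms by (auto simp: direct_sum_def)
  then show ?thesis
    unfolding Iso_monoid_def using direct_sum_unique[OF assms] direct_sum_iso_class[OF assms]
    by (fastforce intro: bexI[of _ A] bexI[of _ B])
qed

lemma Iso_one: "zero_object C Z \<Longrightarrow> \<one>\<^bsub>Iso_monoid C\<^esub> = iso_class C Z"
  by (simp add: Iso_monoid_def zero_object_class)

lemma zero_class: "{Z. zero_object C Z} = \<one>\<^bsub>Iso_monoid C\<^esub>"
  by (simp add: Iso_monoid_def)

lemma comm_monoid_Iso: "comm_monoid (Iso_monoid C)"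
proof (intro comm_monoidI)
  fix P Q R assume "P \<in> carrier (Iso_monoid C)" "Q \<in> carrier (Iso_monoid C)" "R \<in> carrier (Iso_monoid C)"
  then obtain A B D where A: "A \<in> Obj C" "P = iso_class C A" and B: "B \<in> Obj C" "Q = iso_class C B"
    and D: "D \<in> Obj C" "R = iso_class C D" by (auto elim!: Iso_cases)
  obtain S where S: "direct_sum C A B S" using direct_sum_exists A B by blast
  then have "S \<in> Obj C" by (simp add: direct_sum_def)
  with D obtain T where T: "direct_sum C S D T" using direct_sum_exists by blast
  obtain U where U: "direct_sum C B D U" using direct_sum_exists D B by blast
  show "P \<otimes>\<^bsub>Iso_monoid C\<^esub> Q \<otimes>\<^bsub>Iso_monoid C\<^esub> R = P \<otimes>\<^bsub>Iso_monoid C\<^esub> (Q \<otimes>\<^bsub>Iso_monoid C\<^esub> R)"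
    unfolding A B D by (simp only: Iso_mult[OF S] Iso_mult[OF T] Iso_mult[OF U] Iso_mult[OF direct_sum_assoc[OF S T U]])
next
  fix P Q assume "P \<in> carrier (Iso_monoid C)" "Q \<in> carrier (Iso_monoid C)"
  then obtain A B where A: "A \<in> Obj C" "P = iso_class C A" and B: "B \<in> Obj C" "Q = iso_class C B"
    by (auto elim!: Iso_cases)
  obtain S where S: "direct_sum C A B S" using direct_sum_exists A B by blast
  show "P \<otimes>\<^bsub>Iso_monoid C\<^esub> Q \<in> carrier (Iso_monoid C)"
    using S unfolding A B Iso_mult[OF S] by (simp add: direct_sum_def)
  show "P \<otimes>\<^bsub>Iso_monoid C\<^esub> Q = Q \<otimes>\<^bsub>Iso_monoid C\<^esub> P"
    unfolding A B by (simp only: Iso_mult[OF S] Iso_mult[OF direct_sum_commute[OF S]])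
next
  obtain Z where Z: "zero_object C Z" using zero_object_exists by blast
  then show "\<one>\<^bsub>Iso_monoid C\<^esub> \<in> carrier (Iso_monoid C)"
    using zero_object_iff by (simp add: Iso_one)
  fix P assume "P \<in> carrier (Iso_monoid C)"
  then obtain X where "X \<in> Obj C" "P = iso_class C X" by (auto elim: Iso_cases)
  then show "\<one>\<^bsub>Iso_monoid C\<^esub> \<otimes>\<^bsub>Iso_monoid C\<^esub> P = P"
    using Iso_mult[OF direct_sum_zero[OF Z]] Iso_one[OF Z] by simp
qed

end

section \<open>Hom numbers and short exact sequences\<close>

text \<open>\<open>S\<close> is the disjoint union of the fibres of \<open>f\<close> over its image.
  Below, \<open>f\<close> is composition with one map of a short exact sequence.\<close>

lemma card_le_fibres:
  assumes "finite S" "\<And>x0. x0 \<in> S \<Longrightarrow> card {x \<in> S. f x = f x0} \<le> k"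
  shows "card S \<le> card (f ` S) * k"
proof -
  have "card S = (\<Sum>y \<in> f ` S. card {x \<in> S. f x = y})"
    using sum.image_gen[OF assms(1), of "\<lambda>_. 1::nat" f] by simp
  also have "\<dots> \<le> (\<Sum>y \<in> f ` S. k)" using assms(2) by (intro sum_mono) auto
  finally show ?thesis by simp
qed

text \<open>\<open>is_kernel\<close> quantifies the objects existentially. An arrow determines its
  domain and codomain, so they are the objects named by the \<open>Hom\<close> memberships.\<close>

lemma is_kernelD:
  assumes "is_kernel C i p" "i \<in> Hom C B X" "p \<in> Hom C X A"
  shows "p \<cdot>\<^bsub>C\<^esub> i = Zero C B A"
    "g \<in> Hom C T X \<Longrightarrow> p \<cdot>\<^bsub>C\<^esub> g = Zero C T A \<Longrightarrow> \<exists>!u. u \<in> Hom C T B \<and> i \<cdot>\<^bsub>C\<^esub> u = g"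
proof -
  have *: "p \<cdot>\<^bsub>C\<^esub> i = Zero C B A \<and> (\<forall>T g. g \<in> Hom C T X \<longrightarrow> p \<cdot>\<^bsub>C\<^esub> g = Zero C T A \<longrightarrow>
    (\<exists>!u. u \<in> Hom C T B \<and> i \<cdot>\<^bsub>C\<^esub> u = g))"
  proof -
    obtain B' X' A' where K: "i \<in> Hom C B' X'" "p \<in> Hom C X' A'" "p \<cdot>\<^bsub>C\<^esub> i = Zero C B' A' \<and>
      (\<forall>T g. g \<in> Hom C T X' \<longrightarrow> p \<cdot>\<^bsub>C\<^esub> g = Zero C T A' \<longrightarrow>
        (\<exists>!u. u \<in> Hom C T B' \<and> i \<cdot>\<^bsub>C\<^esub> u = g))"
      using assms(1) unfolding is_kernel_def by metis
    then have "B' = B" "X' = X" "A' = A" using assms(2,3) by (auto simp: Hom_def)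
    with K(3) show ?thesis by simp
  qed
  show "p \<cdot>\<^bsub>C\<^esub> i = Zero C B A" using * by simp
  show "g \<in> Hom C T X \<Longrightarrow> p \<cdot>\<^bsub>C\<^esub> g = Zero C T A \<Longrightarrow> \<exists>!u. u \<in> Hom C T B \<and> i \<cdot>\<^bsub>C\<^esub> u = g"
    using * by simp
qed

lemma is_cokernelD:
  assumes "is_cokernel C p i" "i \<in> Hom C B X" "p \<in> Hom C X A"
    and "g \<in> Hom C X T" "g \<cdot>\<^bsub>C\<^esub> i = Zero C B T"
  shows "\<exists>!u. u \<in> Hom C A T \<and> u \<cdot>\<^bsub>C\<^esub> p = g"
proof -
  obtain B' X' A' where K: "i \<in> Hom C B' X'" "p \<in> Hom C X' A'"
    "\<forall>T g. g \<in> Hom C X' T \<longrightarrow> g \<cdot>\<^bsub>C\<^esub> i = Zero C B' T \<longrightarrow>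
      (\<exists>!u. u \<in> Hom C A' T \<and> u \<cdot>\<^bsub>C\<^esub> p = g)"
    using assms(1) unfolding is_cokernel_def by metis
  then have "B' = B" "X' = X" "A' = A" using assms(2,3) by (auto simp: Hom_def)
  with K(3) assms(4,5) show ?thesis by simp
qed

section \<open>Multiplicativity of Hom numbers\<close>

context finitary_exact_category
begin

interpretation I: comm_monoid "Iso_monoid C"
  by (rule comm_monoid_Iso)

definition hom_number :: "'o set \<Rightarrow> 'o set \<Rightarrow> nat" where
  "hom_number P Q = card (Hom C (SOME A. A \<in> P) (SOME B. B \<in> Q))"

lemma hom_number_class:
  assumes "A \<in> Obj C" "B \<in> Obj C"
  shows "hom_number (iso_class C A) (iso_class C B) = card (Hom C A B)"
proof (rule antisym)
  have some: "(SOME X. X \<in> iso_class C Y) \<in> iso_class C Y" "Y \<in> iso_class C (SOME X. X \<in> iso_class C Y)"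
    "(SOME X. X \<in> iso_class C Y) \<in> Obj C" if "Y \<in> Obj C" for Y
    using some_rep[OF iso_class_in_Iso[OF that]] self_in_iso_class that by metis+
  show "hom_number (iso_class C A) (iso_class C B) \<le> card (Hom C A B)"
    unfolding hom_number_def
    by (intro card_Hom_le finite_hom some assms)
  show "card (Hom C A B) \<le> hom_number (iso_class C A) (iso_class C B)"
    unfolding hom_number_def
    by (intro card_Hom_le finite_hom some assms)
qed

lemma card_Hom_pos: "A \<in> Obj C \<Longrightarrow> B \<in> Obj C \<Longrightarrow> 0 < card (Hom C A B)"
  unfolding card_gt_0_iff using finite_hom zero_in_Hom by blast

lemma hom_number_pos:
  assumes "P \<in> Iso C" "Q \<in> Iso C"
  shows "0 < hom_number P Q"
proof -
  obtain A where "A \<in> Obj C" "P = iso_class C A" using assms(1) by (rule Iso_cases)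
  moreover obtain B where "B \<in> Obj C" "Q = iso_class C B" using assms(2) by (rule Iso_cases)
  ultimately show ?thesis
    by (simp add: hom_number_class card_Hom_pos)
qed

text \<open>A biproduct is a product, so a morphism into it is a pair of components. With the dual
  statement for coproducts, \<open>#End\<close> of a direct sum becomes a product of four Hom
  numbers.\<close>

lemma hom_number_mult_right:
  assumes "P \<in> Iso C" "Q \<in> Iso C" "R \<in> Iso C"
  shows "hom_number P (Q \<otimes>\<^bsub>Iso_monoid C\<^esub> R) = hom_number P Q * hom_number P R"
proof -
  obtain W where W: "W \<in> Obj C" "P = iso_class C W" using assms(1) by (rule Iso_cases)
  obtain A where A: "A \<in> Obj C" "Q = iso_class C A" using assms(2) by (rule Iso_cases)
  obtain B where B: "B \<in> Obj C" "R = iso_class C B" using assms(3) by (rule Iso_cases)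
  obtain S where S: "direct_sum C A B S" using direct_sum_exists A B by blast
  then obtain iA iB pA pB where bi: "biproduct C A B S iA iB pA pB" by (auto simp: direct_sum_def)
  note D = biproductD[OF bi] and R = biproduct_reassoc[OF bi]
  have "bij_betw (\<lambda>f. (pA \<cdot> f, pB \<cdot> f)) (Hom C W S) (Hom C W A \<times> Hom C W B)"
    by (rule bij_betw_byWitness[where f' = "\<lambda>(a, b). iA \<cdot> a \<boxplus> iB \<cdot> b"])
      (simp_all add: D R Hom_def image_subset_iff)
  then have "card (Hom C W S) = card (Hom C W A) * card (Hom C W B)"
    using bij_betw_same_card by (fastforce simp: card_cartesian_product)
  then show ?thesis
    unfolding W A B Iso_mult[OF S] using W A B S by (simp add: hom_number_class direct_sum_def)
qed

lemma hom_number_mult_left: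
  assumes "P \<in> Iso C" "Q \<in> Iso C" "R \<in> Iso C"
  shows "hom_number (Q \<otimes>\<^bsub>Iso_monoid C\<^esub> R) P = hom_number Q P * hom_number R P"
proof -
  obtain W where W: "W \<in> Obj C" "P = iso_class C W" using assms(1) by (rule Iso_cases)
  obtain A where A: "A \<in> Obj C" "Q = iso_class C A" using assms(2) by (rule Iso_cases)
  obtain B where B: "B \<in> Obj C" "R = iso_class C B" using assms(3) by (rule Iso_cases)
  obtain S where S: "direct_sum C A B S" using direct_sum_exists A B by blast
  then obtain iA iB pA pB where bi: "biproduct C A B S iA iB pA pB" by (auto simp: direct_sum_def)
  note D = biproductD[OF bi] and R = biproduct_reassoc[OF bi]
  \<comment> \<open>Completeness of the biproduct composed with \<open>f\<close> on the left.
    Distributivity is removed from the simpset, as it would split the sum before the sum is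
    recognised as the identity.\<close>
  have id: "f \<cdot> (iA \<cdot> pA) \<boxplus> f \<cdot> (iB \<cdot> pB) = f" if "f \<in> Arr C" "Dom C f = S" for f
    using that comp_distrib(1)[of "iA \<cdot> pA" "iB \<cdot> pB" f] D by (simp del: comp_distrib)
  have "bij_betw (\<lambda>f. (f \<cdot> iA, f \<cdot> iB)) (Hom C S W) (Hom C A W \<times> Hom C B W)"
    by (rule bij_betw_byWitness[where f' = "\<lambda>(a, b). a \<cdot> pA \<boxplus> b \<cdot> pB"])
      (simp_all add: D id Hom_def image_subset_iff)
  then have "card (Hom C S W) = card (Hom C A W) * card (Hom C B W)"
    using bij_betw_same_card by (fastforce simp: card_cartesian_product)
  then show ?thesis
    unfolding W A B Iso_mult[OF S] using W A B S by (simp add: hom_number_class direct_sum_def)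
qed

section \<open>Left exactness, splitting and the degeneration order\<close>

text \<open>Two morphisms with the same composite with \<open>p\<close> differ by one that factors
  through the kernel \<open>i\<close>, so each fibre is covered by a translate of
  \<open>Hom C W B\<close>. The bound keeps the size of the image, because strictness will come from
  the image being proper.\<close>

lemma card_Hom_ses_left:
  assumes "(i, p) \<in> short_exact_sequences C A B X" "W \<in> Obj C"
  shows "card (Hom C W X) \<le> card ((\<lambda>g. p \<cdot> g) ` Hom C W X) * card (Hom C W B)"
proof -
  have i: "i \<in> Hom C B X" and p: "p \<in> Hom C X A" and "is_kernel C i p"
    using assms kernel_cokernel by (auto simp: short_exact_sequences_def)
  then have ker: "\<exists>u. u \<in> Hom C W B \<and> i \<cdot> u = g"
    if "g \<in> Hom C W X" "p \<cdot> g = Zero C W A" for g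
    using is_kernelD(2)[OF \<open>is_kernel C i p\<close> i p] that by blast
  have obj: "A \<in> Obj C" "B \<in> Obj C" "X \<in> Obj C" using i p dom_cod by (auto simp: Hom_def)
  have fin: "finite (Hom C W X)" "finite (Hom C W B)" using obj assms finite_hom by auto
  have "card {g \<in> Hom C W X. p \<cdot> g = p \<cdot> g0} \<le> card (Hom C W B)" if g0: "g0 \<in> Hom C W X" for g0
  proof -
    obtain n where n: "n \<in> Hom C W X" "g0 \<boxplus> n = Zero C W X" "n \<boxplus> g0 = Zero C W X"
      using add_inverse[OF g0] .
    have "\<exists>u. u \<in> Hom C W B \<and> g = i \<cdot> u \<boxplus> g0" if g: "g \<in> Hom C W X" "p \<cdot> g = p \<cdot> g0" for g
    proof -
      have "p \<cdot> (g \<boxplus> n) = p \<cdot> (g0 \<boxplus> n)" using g g0 n(1) p by (simp add: Hom_def)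
      then have "p \<cdot> (g \<boxplus> n) = Zero C W A" using n p assms by (auto simp: Hom_def)
      moreover have "g \<boxplus> n \<in> Hom C W X" using g n by (simp add: Hom_def)
      ultimately obtain u where u: "u \<in> Hom C W B" "i \<cdot> u = g \<boxplus> n" using ker by blast
      have "g = g \<boxplus> n \<boxplus> g0" using g n g0 by (auto simp: add_assoc Hom_def)
      with u show ?thesis by auto
    qed
    then have "{g \<in> Hom C W X. p \<cdot> g = p \<cdot> g0} \<subseteq> (\<lambda>u. i \<cdot> u \<boxplus> g0) ` Hom C W B" by blast
    then show ?thesis by (rule surj_card_le[OF fin(2)])
  qed
  then show ?thesis by (rule card_le_fibres[OF fin(1)])
qed

text \<open>Dual count: morphisms that agree after composition with \<open>i\<close> differ by one
  that factors through the cokernel \<open>p\<close>.\<close>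

lemma card_Hom_ses_right:
  assumes "(i, p) \<in> short_exact_sequences C A B X" "W \<in> Obj C"
  shows "card (Hom C X W) \<le> card ((\<lambda>g. g \<cdot> i) ` Hom C X W) * card (Hom C A W)"
proof -
  have i: "i \<in> Hom C B X" and p: "p \<in> Hom C X A" and "is_cokernel C p i"
    using assms kernel_cokernel by (auto simp: short_exact_sequences_def)
  then have coker: "\<exists>u. u \<in> Hom C A W \<and> u \<cdot> p = g"
    if "g \<in> Hom C X W" "g \<cdot> i = Zero C B W" for g
    using is_cokernelD[OF \<open>is_cokernel C p i\<close> i p] that by blast
  have obj: "A \<in> Obj C" "B \<in> Obj C" "X \<in> Obj C" using i p dom_cod by (auto simp: Hom_def)
  have fin: "finite (Hom C X W)" "finite (Hom C A W)" using obj assms finite_hom by auto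
  have "card {g \<in> Hom C X W. g \<cdot> i = g0 \<cdot> i} \<le> card (Hom C A W)" if g0: "g0 \<in> Hom C X W" for g0
  proof -
    obtain n where n: "n \<in> Hom C X W" "g0 \<boxplus> n = Zero C X W" "n \<boxplus> g0 = Zero C X W"
      using add_inverse[OF g0] .
    have "\<exists>u. u \<in> Hom C A W \<and> g = u \<cdot> p \<boxplus> g0" if g: "g \<in> Hom C X W" "g \<cdot> i = g0 \<cdot> i" for g
    proof -
      have "(g \<boxplus> n) \<cdot> i = (g0 \<boxplus> n) \<cdot> i" using g g0 n(1) i by (simp add: Hom_def)
      then have "(g \<boxplus> n) \<cdot> i = Zero C B W" using n i assms by (auto simp: Hom_def)
      moreover have "g \<boxplus> n \<in> Hom C X W" using g n by (simp add: Hom_def)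
      ultimately obtain u where u: "u \<in> Hom C A W" "u \<cdot> p = g \<boxplus> n" using coker by blast
      have "g = g \<boxplus> n \<boxplus> g0" using g n g0 by (auto simp: add_assoc Hom_def)
      with u show ?thesis by auto
    qed
    then have "{g \<in> Hom C X W. g \<cdot> i = g0 \<cdot> i} \<subseteq> (\<lambda>u. u \<cdot> p \<boxplus> g0) ` Hom C A W" by blast
    then show ?thesis by (rule surj_card_le[OF fin(2)])
  qed
  then show ?thesis by (rule card_le_fibres[OF fin(1)])
qed

text \<open>The splitting lemma: \<open>1 - s p\<close> is killed by \<open>p\<close>, hence equals
  \<open>i t\<close> for some \<open>t\<close>, and \<open>s\<close>, \<open>i\<close>,
  \<open>p\<close>, \<open>t\<close> then form a biproduct.\<close>

lemma section_direct_sum: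
  assumes "(i, p) \<in> short_exact_sequences C A B X" "s \<in> Hom C A X" "p \<cdot> s = Ident C A"
  shows "direct_sum C A B X"
proof -
  have i: "i \<in> Hom C B X" and p: "p \<in> Hom C X A" and "is_kernel C i p"
    using assms kernel_cokernel by (auto simp: short_exact_sequences_def)
  then have pi: "p \<cdot> i = Zero C B A"
    and ker: "\<And>T g. g \<in> Hom C T X \<Longrightarrow> p \<cdot> g = Zero C T A \<Longrightarrow> \<exists>!u. u \<in> Hom C T B \<and> i \<cdot> u = g"
    using is_kernelD[OF _ i p] by auto
  have obj: "A \<in> Obj C" "B \<in> Obj C" "X \<in> Obj C" using i p dom_cod by (auto simp: Hom_def)
  have arr: "i \<in> Arr C" "p \<in> Arr C" "s \<in> Arr C" "Dom C i = B" "Cod C i = X" "Dom C p = X" "Cod C p = A"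
    "Dom C s = A" "Cod C s = X" using i p assms(2) by (auto simp: Hom_def)
  have ps: "p \<cdot> (s \<cdot> f) = f" if "f \<in> Arr C" "Cod C f = A" for f
    using that arr assms(3) arr_assoc[of f s p] by (simp del: arr_assoc)
  have pi': "p \<cdot> (i \<cdot> f) = Zero C (Dom C f) A" if "f \<in> Arr C" "Cod C f = B" for f
    using that arr pi obj arr_assoc[of f i p] by (simp del: arr_assoc)
  \<comment> \<open>Uniqueness in the kernel property makes \<open>i\<close> a monomorphism, so the
    equations for \<open>t\<close> can be checked after composing with \<open>i\<close>.\<close>
  have inj: "u = v" if "u \<in> Hom C T B" "v \<in> Hom C T B" "i \<cdot> u = i \<cdot> v" for u v T
  proof -
    have "T \<in> Obj C" using that by (auto simp: Hom_def)
    then have "i \<cdot> v \<in> Hom C T X" "p \<cdot> (i \<cdot> v) = Zero C T A"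
      using that arr pi' by (auto simp: Hom_def)
    from ker[OF this] that show ?thesis by auto
  qed
  have sp: "s \<cdot> p \<in> Hom C X X" using arr by (simp add: Hom_def)
  obtain n where n: "n \<in> Hom C X X" "s \<cdot> p \<boxplus> n = Zero C X X" "n \<boxplus> s \<cdot> p = Zero C X X"
    using add_inverse[OF sp] .
  have n': "n \<in> Arr C" "Dom C n = X" "Cod C n = X" using n by (auto simp: Hom_def)
  \<comment> \<open>Since \<open>n\<close> is the negative of \<open>s \<cdot> p\<close>, this is
    the complementary map \<open>1 - s p\<close>.\<close>
  define d where "d = Ident C X \<boxplus> n"
  have d: "d \<in> Arr C" "Dom C d = X" "Cod C d = X" using n' obj by (simp_all add: d_def)
  have dsp: "d \<boxplus> s \<cdot> p = Ident C X" using n n' obj arr by (simp add: d_def add_assoc)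
  have "p \<cdot> d = p \<cdot> (s \<cdot> p \<boxplus> n)" using n' obj arr by (simp add: d_def ps)
  then have "p \<cdot> d = Zero C X A" using n(2) arr obj by simp
  with ker[of d X] d obtain t where t: "t \<in> Hom C X B" "i \<cdot> t = d" by (auto simp: Hom_def)
  have t': "t \<in> Arr C" "Dom C t = X" "Cod C t = B" using t by (auto simp: Hom_def)
  have *: "d \<cdot> f \<boxplus> s \<cdot> (p \<cdot> f) = f" if "f \<in> Arr C" "Cod C f = X" for f
  proof -
    have "d \<cdot> f \<boxplus> s \<cdot> (p \<cdot> f) = (d \<boxplus> s \<cdot> p) \<cdot> f" using that d arr by simp
    then show ?thesis using that by (simp add: dsp)
  qed
  have "i \<cdot> (t \<cdot> i) = d \<cdot> i" using arr t' t(2) arr_assoc[of i t i] by (simp del: arr_assoc)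
  also have "d \<cdot> i = i" using *[of i] arr d obj by (simp add: pi)
  also have "i = i \<cdot> Ident C B" using arr by simp
  finally have "i \<cdot> (t \<cdot> i) = i \<cdot> Ident C B" .
  then have ti: "t \<cdot> i = Ident C B"
    by (rule inj[of _ B, rotated 2]) (simp_all add: Hom_def arr t' obj)
  \<comment> \<open>Adding the negative \<open>m\<close> of \<open>s\<close> turns this into
    \<open>d \<cdot> s = 0\<close>.\<close>
  have "d \<cdot> s \<boxplus> s = s" using *[of s] arr assms(3) by simp
  obtain m where m: "m \<in> Hom C A X" "s \<boxplus> m = Zero C A X" using add_inverse[OF assms(2)] .
  have "d \<cdot> s = d \<cdot> s \<boxplus> (s \<boxplus> m)" using m arr d obj by simp
  also have "\<dots> = (d \<cdot> s \<boxplus> s) \<boxplus> m" using m(1) arr d by (simp add: add_assoc Hom_def)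
  also have "\<dots> = Zero C A X" using \<open>d \<cdot> s \<boxplus> s = s\<close> m by simp
  also have "Zero C A X = i \<cdot> Zero C A B" using arr obj by simp
  finally have "i \<cdot> (t \<cdot> s) = i \<cdot> Zero C A B"
    using arr t' t(2) arr_assoc[of s t i] by (simp del: arr_assoc)
  then have ts: "t \<cdot> s = Zero C A B"
    by (rule inj[of _ A, rotated 2]) (simp_all add: Hom_def arr t' obj)
  have "s \<cdot> p \<boxplus> i \<cdot> t = Ident C X"
    using add_commute[of "s \<cdot> p" d] arr d dsp t(2) by simp
  then have "biproduct C A B X s i p t"
    unfolding biproduct_def by (simp add: Hom_def arr t' assms(3) pi ti ts)
  then show ?thesis using obj by (auto simp: direct_sum_def)
qed

text \<open>
  A bound on \<open>#End\<close> alone would not be stable under adding a summand, hence the comparison with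
  all test classes \<open>W\<close>.
\<close>

definition degenerates :: "'o set \<Rightarrow> 'o set \<Rightarrow> bool" (infix "\<prec>" 50) where
  "R \<prec> S \<longleftrightarrow> R \<in> Iso C \<and> S \<in> Iso C \<and>
     (\<forall>W \<in> Iso C. hom_number W R \<le> hom_number W S \<and> hom_number R W \<le> hom_number S W) \<and>
     hom_number R R < hom_number S S"

lemma degenerates_trans: "R \<prec> S \<Longrightarrow> S \<prec> T \<Longrightarrow> R \<prec> T"
  unfolding degenerates_def by (meson le_trans less_trans)

text \<open>Both \<open>#End\<close> numbers expand into four factors. The factor of
  \<open>P\<close> with itself is common, the two mixed ones are compared by taking \<open>P\<close>
  as test class, and the last is strictly smaller; positivity keeps the product strict.\<close>

lemma degenerates_mult:
  assumes "R \<prec> S" "P \<in> Iso C"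
  shows "P \<otimes>\<^bsub>Iso_monoid C\<^esub> R \<prec> P \<otimes>\<^bsub>Iso_monoid C\<^esub> S"
proof -
  have le: "hom_number W R \<le> hom_number W S" "hom_number R W \<le> hom_number S W" if "W \<in> Iso C" for W
    using assms that by (auto simp: degenerates_def)
  have RS: "R \<in> Iso C" "S \<in> Iso C" "hom_number R R < hom_number S S"
    using assms by (auto simp: degenerates_def)
  have 1: "hom_number R P * hom_number R R < hom_number S P * hom_number S S"
    using RS le(2)[OF assms(2)] hom_number_pos[OF RS(1) assms(2)] by (intro mult_le_less_imp_less) auto
  have 2: "hom_number P P * hom_number P R \<le> hom_number P P * hom_number P S"
    using le(1)[OF assms(2)] by simp
  have 3: "0 < hom_number P P * hom_number P R" using hom_number_pos assms RS by simp
  have "hom_number P P * hom_number P R * (hom_number R P * hom_number R R) <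
      hom_number P P * hom_number P S * (hom_number S P * hom_number S S)"
    by (rule mult_le_less_imp_less[OF 2 1 3 zero_le])
  moreover have "P \<otimes>\<^bsub>Iso_monoid C\<^esub> T \<in> Iso C" if "T \<in> Iso C" for T
    using that assms(2) I.m_closed by simp
  ultimately show ?thesis
    unfolding degenerates_def using RS assms(2) le
    by (simp add: hom_number_mult_left hom_number_mult_right ac_simps)
qed

text \<open>Unless \<open>X\<close> is a direct sum of \<open>A\<close> and \<open>B\<close>, the
  map \<open>p\<close> has no section, so the identity of \<open>A\<close> is missed by composition
  with \<open>p\<close> and \<open>#Hom(A, X)\<close> drops strictly. For \<open>#End(X)\<close> the
  sequence is used twice: first to bound it by \<open>#Hom(A, X)\<close> times
  \<open>#Hom(B, X)\<close>, then to bound each of these factors.\<close>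

lemma ses_degenerates:
  assumes "short_exact_sequences C A B X \<noteq> {}"
  shows "iso_class C X = iso_class C A \<otimes>\<^bsub>Iso_monoid C\<^esub> iso_class C B \<or>
    iso_class C X \<prec> iso_class C A \<otimes>\<^bsub>Iso_monoid C\<^esub> iso_class C B"
proof (cases "direct_sum C A B X")
  case True
  then show ?thesis using Iso_mult by simp
next
  case False
  obtain i p where ip: "(i, p) \<in> short_exact_sequences C A B X" using assms by auto
  then have i: "i \<in> Hom C B X" and p: "p \<in> Hom C X A" by (auto simp: short_exact_sequences_def)
  then have obj: "A \<in> Obj C" "B \<in> Obj C" "X \<in> Obj C" using dom_cod by (auto simp: Hom_def)
  have sub: "(\<lambda>g. p \<cdot> g) ` Hom C W X \<subseteq> Hom C W A" "(\<lambda>g. g \<cdot> i) ` Hom C X W \<subseteq> Hom C B W" for W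
    using i p by (auto simp: Hom_def)
  have left: "card (Hom C W X) \<le> card (Hom C W A) * card (Hom C W B)" if "W \<in> Obj C" for W
  proof -
    have "card ((\<lambda>g. p \<cdot> g) ` Hom C W X) \<le> card (Hom C W A)"
      using sub(1) finite_hom obj that by (intro card_mono) auto
    then have "card ((\<lambda>g. p \<cdot> g) ` Hom C W X) * card (Hom C W B) \<le> card (Hom C W A) * card (Hom C W B)"
      by (rule mult_le_mono1)
    with card_Hom_ses_left[OF ip that] show ?thesis by linarith
  qed
  have right: "card (Hom C X W) \<le> card (Hom C A W) * card (Hom C B W)" if "W \<in> Obj C" for W
  proof -
    have "card ((\<lambda>g. g \<cdot> i) ` Hom C X W) \<le> card (Hom C B W)"
      using sub(2) finite_hom obj that by (intro card_mono) auto
    then have "card ((\<lambda>g. g \<cdot> i) ` Hom C X W) * card (Hom C A W) \<le> card (Hom C B W) * card (Hom C A W)"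
      by (rule mult_le_mono1)
    with card_Hom_ses_right[OF ip that] have "card (Hom C X W) \<le> card (Hom C B W) * card (Hom C A W)"
      by linarith
    then show ?thesis by (simp only: mult.commute)
  qed
  have "Ident C A \<notin> (\<lambda>g. p \<cdot> g) ` Hom C A X"
    using section_direct_sum[OF ip] False by (metis imageE)
  moreover have "Ident C A \<in> Hom C A A" using ident obj by simp
  ultimately have "(\<lambda>g. p \<cdot> g) ` Hom C A X \<subset> Hom C A A" using sub(1)[of A] by blast
  then have "card ((\<lambda>g. p \<cdot> g) ` Hom C A X) < card (Hom C A A)"
    using finite_hom obj by (intro psubset_card_mono)
  then have "card ((\<lambda>g. p \<cdot> g) ` Hom C A X) * card (Hom C A B) < card (Hom C A A) * card (Hom C A B)"
    using card_Hom_pos obj by simp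
  then have "card (Hom C A X) < card (Hom C A A) * card (Hom C A B)"
    using card_Hom_ses_left[OF ip obj(1)] by linarith
  then have "card (Hom C A X) * card (Hom C B X) <
      (card (Hom C A A) * card (Hom C A B)) * (card (Hom C B A) * card (Hom C B B))"
    using left[OF obj(2)] card_Hom_pos obj by (intro mult_less_le_imp_less) auto
  then have strict: "card (Hom C X X) <
      (card (Hom C A A) * card (Hom C A B)) * (card (Hom C B A) * card (Hom C B B))"
    using right[OF obj(3)] by linarith
  have "iso_class C A \<otimes>\<^bsub>Iso_monoid C\<^esub> iso_class C B \<in> Iso C"
    using I.m_closed obj by simp
  then have "iso_class C X \<prec> iso_class C A \<otimes>\<^bsub>Iso_monoid C\<^esub> iso_class C B"
    unfolding degenerates_def using obj strict left right
    by (auto simp: hom_number_mult_left hom_number_mult_right hom_number_class ac_simps elim!: Iso_cases)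
  then show ?thesis ..
qed

section \<open>Vanishing of the structure constants of the Hall product\<close>

lemma direct_sum_ses: "direct_sum C A B S \<Longrightarrow> short_exact_sequences C A B S \<noteq> {}"
  using split by (fastforce simp: direct_sum_def short_exact_sequences_def biproduct_def)

lemma finite_ses:
  assumes "A \<in> Obj C" "B \<in> Obj C" "X \<in> Obj C"
  shows "finite (short_exact_sequences C A B X)"
proof -
  have "short_exact_sequences C A B X \<subseteq> Hom C B X \<times> Hom C X A"
    by (auto simp: short_exact_sequences_def)
  then show ?thesis using finite_hom assms by (meson finite_SigmaI finite_subset)
qed

lemma card_automorphisms_pos: "A \<in> Obj C \<Longrightarrow> 0 < card (automorphisms C A)"
  using isomorphisms_ident[of A] finite_subset[OF _ finite_hom, of "automorphisms C A" A A]
  by (auto simp: card_gt_0_iff isomorphisms_def)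

text \<open>Automorphism groups are finite and non-empty and there are finitely many sequences, so
  the quotient vanishes exactly when no sequence exists. Later arguments ask of a coefficient only
  whether it vanishes.\<close>

lemma hall_coeff_nonzero_iff:
  assumes "P \<in> Iso C" "Q \<in> Iso C" "R \<in> Iso C"
  shows "hall_coeff C P Q R \<noteq> 0 \<longleftrightarrow>
    short_exact_sequences C (SOME A. A \<in> P) (SOME B. B \<in> Q) (SOME X. X \<in> R) \<noteq> {}"
  using finite_ses[OF some_rep(1)[OF assms(1)] some_rep(1)[OF assms(2)] some_rep(1)[OF assms(3)]]
    card_automorphisms_pos[OF some_rep(1)[OF assms(1)]]
    card_automorphisms_pos[OF some_rep(1)[OF assms(2)]]
  by (auto simp: hall_coeff_def hall_number_def)

lemma hall_coeff_degenerates: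
  assumes "P \<in> Iso C" "Q \<in> Iso C" "R \<in> Iso C" "hall_coeff C P Q R \<noteq> 0"
  shows "R = P \<otimes>\<^bsub>Iso_monoid C\<^esub> Q \<or> R \<prec> P \<otimes>\<^bsub>Iso_monoid C\<^esub> Q"
  using ses_degenerates assms(4) unfolding hall_coeff_nonzero_iff[OF assms(1-3)]
  by (metis assms(1-3) some_rep(2))

lemma hall_coeff_mult_nonzero:
  assumes "P \<in> Iso C" "Q \<in> Iso C"
  shows "hall_coeff C P Q (P \<otimes>\<^bsub>Iso_monoid C\<^esub> Q) \<noteq> 0"
proof -
  let ?A = "SOME A. A \<in> P" and ?B = "SOME B. B \<in> Q"
  obtain S where S: "direct_sum C ?A ?B S" using direct_sum_exists some_rep assms by metis
  then have PQ: "P \<otimes>\<^bsub>Iso_monoid C\<^esub> Q = iso_class C S" and "S \<in> Obj C"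
    using Iso_mult[OF S] some_rep assms by (auto simp: direct_sum_def)
  \<comment> \<open>The coefficient is evaluated at the chosen representative, which may differ from
    \<open>S\<close>; the direct sum structure has to be carried over to it.\<close>
  then have "(SOME X. X \<in> iso_class C S) \<in> iso_class C S"
    using self_in_iso_class by (metis someI)
  from direct_sum_ses[OF direct_sum_iso_class[OF S this]] show ?thesis
    using assms \<open>S \<in> Obj C\<close> by (simp add: hall_coeff_nonzero_iff PQ)
qed

text \<open>\<open>hall_basis_mult\<close> sums over this set, and a sum over an infinite set would
  be 0 by convention. Finiteness of the possible middle terms rules this out.\<close>

lemma finite_hall_coeff:
  assumes "P \<in> Iso C" "Q \<in> Iso C"
  shows "finite {R \<in> Iso C. hall_coeff C P Q R \<noteq> 0}"
proof (rule finite_subset)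
  show "{R \<in> Iso C. hall_coeff C P Q R \<noteq> 0} \<subseteq>
    iso_class C ` {X. short_exact_sequences C (SOME A. A \<in> P) (SOME B. B \<in> Q) X \<noteq> {}}"
  proof
    fix R assume "R \<in> {R \<in> Iso C. hall_coeff C P Q R \<noteq> 0}"
    then show "R \<in> iso_class C ` {X. short_exact_sequences C (SOME A. A \<in> P) (SOME B. B \<in> Q) X \<noteq> {}}"
      using hall_coeff_nonzero_iff[OF assms] some_rep(2)[of R] by (intro image_eqI[of _ _ "SOME X. X \<in> R"]) auto
  qed
  show "finite (iso_class C ` {X. short_exact_sequences C (SOME A. A \<in> P) (SOME B. B \<in> Q) X \<noteq> {}})"
    using finite_middle_terms some_rep assms by metis
qed

lemma Iso_mult_closed: "P \<in> Iso C \<Longrightarrow> Q \<in> Iso C \<Longrightarrow> P \<otimes>\<^bsub>Iso_monoid C\<^esub> Q \<in> Iso C"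
  using I.m_closed by simp

lemma Iso_one_closed: "\<one>\<^bsub>Iso_monoid C\<^esub> \<in> Iso C"
  using I.one_closed by simp

lemma Ind_subset_Iso: "Ind C \<subseteq> Iso C"
  by (auto simp: Ind_def indecomposable_def)

section \<open>Decomposition of objects into indecomposables\<close>

text \<open>The class of the direct sum of the letters, folded from the right like
  \<open>hall_monomial\<close> so that inductions over a word treat both in parallel.\<close>

definition class_sum :: "'o set list \<Rightarrow> 'o set" where
  "class_sum w = foldr (\<otimes>\<^bsub>Iso_monoid C\<^esub>) w \<one>\<^bsub>Iso_monoid C\<^esub>"

lemma class_sum_simps [simp]:
  "class_sum [] = \<one>\<^bsub>Iso_monoid C\<^esub>"
  "class_sum (x # w) = x \<otimes>\<^bsub>Iso_monoid C\<^esub> class_sum w"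
  by (simp_all add: class_sum_def)

lemma class_sum_closed: "set w \<subseteq> Iso C \<Longrightarrow> class_sum w \<in> Iso C"
  by (induction w) (auto simp: Iso_mult_closed Iso_one_closed)

lemma class_sum_append:
  "set v \<subseteq> Iso C \<Longrightarrow> set w \<subseteq> Iso C \<Longrightarrow>
    class_sum (v @ w) = class_sum v \<otimes>\<^bsub>Iso_monoid C\<^esub> class_sum w"
  by (induction v) (auto simp: I.m_assoc class_sum_closed)

text \<open>The right side is the canonical homomorphism of \<open>freely_generated_by\<close>. In
  particular \<open>class_sum\<close> depends only on the multiset of letters.\<close>

lemma class_sum_finprod:
  assumes "set w \<subseteq> Iso C"
  shows "class_sum w = (\<Otimes>\<^bsub>Iso_monoid C\<^esub> s \<in> set_mset (mset w). s [^]\<^bsub>Iso_monoid C\<^esub> count (mset w) s)"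
proof -
  let ?G = "Iso_monoid C"
  \<comment> \<open>The index set is fixed as some \<open>A\<close> containing all letters, since
    the set of letters changes during the induction. Elements of \<open>A\<close> outside the word
    contribute a zeroth power.\<close>
  have "class_sum w = (\<Otimes>\<^bsub>?G\<^esub> s \<in> A. s [^]\<^bsub>?G\<^esub> count (mset w) s)"
    if "finite A" "A \<subseteq> Iso C" "set w \<subseteq> A" for A
    using that(3)
  proof (induction w)
    case Nil
    then show ?case by simp
  next
    case (Cons x w)
    have pow: "s [^]\<^bsub>?G\<^esub> n \<in> carrier ?G" if "s \<in> A" for s and n :: nat
      using \<open>A \<subseteq> Iso C\<close> that by (intro I.nat_pow_closed) auto
    have "s [^]\<^bsub>?G\<^esub> count (mset (x # w)) s =
        (if x = s then s else \<one>\<^bsub>?G\<^esub>) \<otimes>\<^bsub>?G\<^esub> s [^]\<^bsub>?G\<^esub> count (mset w) s" if "s \<in> A" for s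
      using pow[OF that] that \<open>A \<subseteq> Iso C\<close> I.nat_pow_Suc2[of s] I.l_one by (simp add: subsetD)
    then have "(\<Otimes>\<^bsub>?G\<^esub> s \<in> A. s [^]\<^bsub>?G\<^esub> count (mset (x # w)) s) =
      (\<Otimes>\<^bsub>?G\<^esub> s \<in> A. (if x = s then s else \<one>\<^bsub>?G\<^esub>) \<otimes>\<^bsub>?G\<^esub> s [^]\<^bsub>?G\<^esub> count (mset w) s)"
      using that Iso_one_closed Iso_mult_closed pow
      by (intro I.finprod_cong) (auto simp: Pi_def simp_implies_def subset_iff)
    also have "\<dots> = (\<Otimes>\<^bsub>?G\<^esub> s \<in> A. if x = s then s else \<one>\<^bsub>?G\<^esub>) \<otimes>\<^bsub>?G\<^esub>
        (\<Otimes>\<^bsub>?G\<^esub> s \<in> A. s [^]\<^bsub>?G\<^esub> count (mset w) s)"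
      using that Iso_one_closed pow by (intro I.finprod_multf) auto
    also have "(\<Otimes>\<^bsub>?G\<^esub> s \<in> A. if x = s then s else \<one>\<^bsub>?G\<^esub>) = x"
      using that Cons.prems by (intro I.finprod_singleton) auto
    finally show ?case using Cons by simp
  qed
  from this[of "set w"] assms show ?thesis by simp
qed

lemma card_End_nonzero:
  assumes "X \<in> Obj C" "\<not> zero_object C X"
  shows "1 < card (Hom C X X)"
proof -
  have sub: "{Ident C X, Zero C X X} \<subseteq> Hom C X X" and neq: "Ident C X \<noteq> Zero C X X"
    using assms ident by (auto simp: zero_object_iff)
  have "card {Ident C X, Zero C X X} = 2" using neq by simp
  then show ?thesis using card_mono[OF finite_hom[OF assms(1,1)] sub] by linarith
qed

text \<open>Induction on \<open>#End\<close>: in a decomposition into two nonzero summands,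
  \<open>#End(X)\<close> is a product of four positive factors, among them both endomorphism numbers
  of the summands, each greater than 1. Hence both summands have smaller
  \<open>#End\<close>.\<close>

lemma ex_class_sum_eq:
  assumes "X \<in> Obj C"
  shows "\<exists>w. set w \<subseteq> Ind C \<and> class_sum w = iso_class C X"
  using assms
proof (induction "card (Hom C X X)" arbitrary: X rule: less_induct)
  case less
  consider "zero_object C X" | "indecomposable C X"
    | A B where "direct_sum C A B X" "\<not> zero_object C A" "\<not> zero_object C B"
    using less.prems by (auto simp: indecomposable_def)
  then show ?case
  proof cases
    case 1
    then show ?thesis by (intro exI[of _ "[]"]) (simp add: Iso_one)
  next
    case 2
    then have "iso_class C X \<in> Ind C" by (simp add: Ind_def)
    then show ?thesis using less.prems by (intro exI[of _ "[iso_class C X]"]) simp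
  next
    case 3
    then have obj: "A \<in> Obj C" "B \<in> Obj C" by (auto simp: direct_sum_def)
    then have "card (Hom C X X) =
        (card (Hom C A A) * card (Hom C A B)) * (card (Hom C B A) * card (Hom C B B))"
      using hom_number_class[OF less.prems less.prems] Iso_mult[OF 3(1), symmetric]
      by (simp add: hom_number_mult_left hom_number_mult_right Iso_mult_closed hom_number_class ac_simps)
    \<comment> \<open>Here \<open>x\<close> and \<open>y\<close> are the endomorphism numbers of the
      two summands and \<open>b\<close>, \<open>c\<close> count the morphisms between them.\<close>
    moreover have *: "x < x * b * (c * y)" if "0 < x" "0 < b" "0 < c" "1 < y" for x b c y :: nat
    proof -
      have "1 * y \<le> b * c * y" using that by (intro mult_le_mono1) (simp add: Suc_le_eq)
      then have "1 < b * c * y" using that by linarith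
      then have "x * 1 < x * (b * c * y)" using that(1) by (simp only: mult_less_cancel1)
      then show ?thesis by (simp add: ac_simps)
    qed
    moreover have "card (Hom C A A) < card (Hom C A A) * card (Hom C A B) * (card (Hom C B A) * card (Hom C B B))"
      by (intro * card_Hom_pos card_End_nonzero obj 3)
    moreover have "card (Hom C B B) < card (Hom C A A) * card (Hom C A B) * (card (Hom C B A) * card (Hom C B B))"
      using *[OF card_Hom_pos[OF obj(2,2)] card_Hom_pos[OF obj] card_Hom_pos[OF obj(2,1)] card_End_nonzero[OF obj(1) 3(2)]]
      by (simp add: ac_simps)
    ultimately obtain v w where "set v \<subseteq> Ind C" "class_sum v = iso_class C A"
      "set w \<subseteq> Ind C" "class_sum w = iso_class C B"
      using less.hyps obj by metis
    moreover have "set (v @ w) \<subseteq> Ind C \<Longrightarrow> class_sum (v @ w) = class_sum v \<otimes>\<^bsub>Iso_monoid C\<^esub> class_sum w"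
      using Ind_subset_Iso by (intro class_sum_append) auto
    ultimately show ?thesis using Iso_mult[OF 3(1)] by (intro exI[of _ "v @ w"]) auto
  qed
qed

section \<open>Leading classes in the Hall algebra\<close>

lemma degenerates_irrefl: "\<not> P \<prec> P"
  by (simp add: degenerates_def)

lemma lookup_hall_basis_mult:
  assumes "P \<in> Iso C" "Q \<in> Iso C"
  shows "Poly_Mapping.lookup (hall_basis_mult C P Q) R = (if R \<in> Iso C then hall_coeff C P Q R else 0)"
  using finite_hall_coeff[OF assms]
  by (auto simp: hall_basis_mult_def lookup_sum lookup_single when_def)

lemma lookup_hall_mult_single:
  assumes "P \<in> Iso C" "u \<in> hall_algebra C"
  shows "Poly_Mapping.lookup (hall_mult C (Poly_Mapping.single P 1) u) R =
    (\<Sum>Q \<in> Poly_Mapping.keys u. Poly_Mapping.lookup u Q * (if R \<in> Iso C then hall_coeff C P Q R else 0))"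
proof -
  have "Poly_Mapping.lookup (hall_mult C (Poly_Mapping.single P 1) u) R =
    (\<Sum>Q \<in> Poly_Mapping.keys u. Poly_Mapping.lookup u Q * Poly_Mapping.lookup (hall_basis_mult C P Q) R)"
    by (simp add: hall_mult_def lookup_sum)
  also have "\<dots> = (\<Sum>Q \<in> Poly_Mapping.keys u. Poly_Mapping.lookup u Q * (if R \<in> Iso C then hall_coeff C P Q R else 0))"
    using assms by (intro sum.cong) (auto simp: lookup_hall_basis_mult hall_algebra_def)
  finally show ?thesis .
qed

text \<open>Triangularity with respect to \<prec>, which is only a partial order: every other class
  that occurs must be comparable with the leading one.\<close>

definition has_leading_class :: "('o set \<Rightarrow>\<^sub>0 rat) \<Rightarrow> 'o set \<Rightarrow> bool" where
  "has_leading_class u P \<longleftrightarrow> P \<in> Iso C \<and> Poly_Mapping.lookup u P \<noteq> 0 \<and>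
     (\<forall>R \<in> Poly_Mapping.keys u. R = P \<or> R \<prec> P)"

lemma has_leading_class_in_hall_algebra: "has_leading_class u P \<Longrightarrow> u \<in> hall_algebra C"
  by (auto simp: has_leading_class_def hall_algebra_def degenerates_def)

text \<open>Each class in the product arises from a key \<open>Q'\<close> of \<open>u\<close> and is
  at most the sum of \<open>P\<close> and \<open>Q'\<close>, hence at most that of \<open>P\<close>
  and \<open>Q\<close>. The latter arises from \<open>Q' = Q\<close> alone, since otherwise it would
  lie strictly below itself; so its coefficient is a single nonzero term and cannot cancel.\<close>

lemma has_leading_class_mult:
  assumes P: "P \<in> Iso C" and u: "has_leading_class u Q"
  shows "has_leading_class (hall_mult C (Poly_Mapping.single P 1) u) (P \<otimes>\<^bsub>Iso_monoid C\<^esub> Q)"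
proof -
  let ?PQ = "P \<otimes>\<^bsub>Iso_monoid C\<^esub> Q"
  have Q: "Q \<in> Iso C" "Poly_Mapping.lookup u Q \<noteq> 0"
    and lower: "\<And>Q'. Q' \<in> Poly_Mapping.keys u \<Longrightarrow> Q' = Q \<or> Q' \<prec> Q"
    and uH: "u \<in> hall_algebra C"
    using u has_leading_class_in_hall_algebra by (auto simp: has_leading_class_def)
  have keys: "R = ?PQ \<or> R \<prec> ?PQ"
    if "Q' \<in> Poly_Mapping.keys u" "R \<in> Iso C" "hall_coeff C P Q' R \<noteq> 0" for Q' R
  proof -
    have "Q' \<in> Iso C" using that uH by (auto simp: hall_algebra_def)
    then show ?thesis
      using hall_coeff_degenerates[OF P _ that(2,3)] lower[OF that(1)] degenerates_mult[OF _ P] degenerates_trans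
      by metis
  qed
  have zero: "hall_coeff C P Q' ?PQ = 0" if "Q' \<in> Poly_Mapping.keys u - {Q}" for Q'
  proof (rule ccontr)
    assume *: "hall_coeff C P Q' ?PQ \<noteq> 0"
    have Q': "Q' \<in> Iso C" "Q' \<prec> Q" using that uH lower by (auto simp: hall_algebra_def)
    have "?PQ = P \<otimes>\<^bsub>Iso_monoid C\<^esub> Q' \<or> ?PQ \<prec> P \<otimes>\<^bsub>Iso_monoid C\<^esub> Q'"
      using hall_coeff_degenerates[OF P Q'(1) Iso_mult_closed[OF P Q(1)] *] .
    moreover have "P \<otimes>\<^bsub>Iso_monoid C\<^esub> Q' \<prec> ?PQ" using degenerates_mult[OF Q'(2) P] .
    ultimately have "?PQ \<prec> ?PQ" using degenerates_trans by auto
    then show False using degenerates_irrefl by simp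
  qed
  have "Poly_Mapping.lookup (hall_mult C (Poly_Mapping.single P 1) u) ?PQ =
    (\<Sum>Q' \<in> Poly_Mapping.keys u. Poly_Mapping.lookup u Q' * hall_coeff C P Q' ?PQ)"
    using lookup_hall_mult_single[OF P uH] Iso_mult_closed[OF P Q(1)] by simp
  also have "\<dots> = (\<Sum>Q' \<in> {Q}. Poly_Mapping.lookup u Q' * hall_coeff C P Q' ?PQ)"
    using Q zero by (intro sum.mono_neutral_right) (auto simp: in_keys_iff)
  finally have "Poly_Mapping.lookup (hall_mult C (Poly_Mapping.single P 1) u) ?PQ \<noteq> 0"
    using hall_coeff_mult_nonzero[OF P Q(1)] Q by simp
  moreover have "R = ?PQ \<or> R \<prec> ?PQ"
    if "R \<in> Poly_Mapping.keys (hall_mult C (Poly_Mapping.single P 1) u)" for R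
  proof -
    have "(\<Sum>Q \<in> Poly_Mapping.keys u. Poly_Mapping.lookup u Q * (if R \<in> Iso C then hall_coeff C P Q R else 0)) \<noteq> 0"
      using that lookup_hall_mult_single[OF P uH, of R] by (simp add: in_keys_iff)
    then obtain Q' where "Q' \<in> Poly_Mapping.keys u"
      "Poly_Mapping.lookup u Q' * (if R \<in> Iso C then hall_coeff C P Q' R else 0) \<noteq> 0"
      by (rule sum.not_neutral_contains_not_neutral)
    then show ?thesis using keys by (auto split: if_splits)
  qed
  ultimately show ?thesis
    using Iso_mult_closed[OF P Q(1)] by (auto simp: has_leading_class_def)
qed

lemma hall_monomial_leading_class:
  "set w \<subseteq> Iso C \<Longrightarrow> has_leading_class (hall_monomial C w) (class_sum w)"
proof (induction w)
  case Nil
  show ?case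
    by (auto simp: hall_monomial_def hall_unit_def zero_class has_leading_class_def Iso_one_closed)
next
  case (Cons x w)
  then show ?case using has_leading_class_mult by (simp add: hall_monomial_def)
qed

lemma has_leading_class_unique:
  assumes "has_leading_class u P" "has_leading_class u Q"
  shows "P = Q"
proof (rule ccontr)
  assume "P \<noteq> Q"
  then have "P \<prec> Q" "Q \<prec> P" using assms by (auto simp: has_leading_class_def in_keys_iff)
  then show False using degenerates_trans degenerates_irrefl by metis
qed

section \<open>Spanning and independence by triangularity\<close>

lemma in_span_of_singles:
  assumes "\<And>R. R \<in> Poly_Mapping.keys u \<Longrightarrow> Poly_Mapping.single R 1 \<in> hall.span S"
  shows "u \<in> hall.span S"
proof -
  have "(\<Sum>R \<in> Poly_Mapping.keys u. hall_scale (Poly_Mapping.lookup u R) (Poly_Mapping.single R 1)) = u"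
    by (rule poly_mapping_eqI) (auto simp: lookup_sum lookup_single when_def in_keys_iff if_distrib cong: if_cong)
  moreover have "(\<Sum>R \<in> Poly_Mapping.keys u. hall_scale (Poly_Mapping.lookup u R) (Poly_Mapping.single R 1)) \<in> hall.span S"
    using assms by (intro hall.span_sum hall.span_scale)
  ultimately show ?thesis by simp
qed

lemma subspace_hall_algebra: "hall.subspace (hall_algebra C)"
proof -
  have "hall_algebra C = {u. \<forall>R. R \<notin> Iso C \<longrightarrow> Poly_Mapping.lookup u R = 0}"
    by (auto simp: hall_algebra_def in_keys_iff)
  then show ?thesis by (simp add: hall.subspace_def lookup_add)
qed

text \<open>Induction on \<open>hom_number P P\<close>: removing the leading term from an element of
  \<open>S\<close> with leading class \<open>P\<close> leaves only classes of smaller endomorphism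
  number, which lie in the span already.\<close>

lemma span_eq_hall_algebra:
  assumes "\<And>P. P \<in> Iso C \<Longrightarrow> \<exists>u \<in> S. has_leading_class u P" "S \<subseteq> hall_algebra C"
  shows "hall.span S = hall_algebra C"
proof
  show "hall.span S \<subseteq> hall_algebra C"
    by (rule hall.span_minimal[OF assms(2) subspace_hall_algebra])
  have "Poly_Mapping.single P 1 \<in> hall.span S" if "P \<in> Iso C" for P
    using that
  proof (induction "hom_number P P" arbitrary: P rule: less_induct)
    case less
    then obtain u where u: "u \<in> S" "has_leading_class u P" using assms(1) by auto
    define c where "c = Poly_Mapping.lookup u P"
    have c: "c \<noteq> 0" using u by (simp add: c_def has_leading_class_def)
    have "u - hall_scale c (Poly_Mapping.single P 1) \<in> hall.span S"
    proof (rule in_span_of_singles)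
      fix R assume R: "R \<in> Poly_Mapping.keys (u - hall_scale c (Poly_Mapping.single P 1))"
      then have "R \<noteq> P" "R \<in> Poly_Mapping.keys u"
        by (auto simp: in_keys_iff lookup_minus lookup_single c_def when_def split: if_splits)
      then have "R \<prec> P" using u by (auto simp: has_leading_class_def)
      then show "Poly_Mapping.single R 1 \<in> hall.span S"
        using less.hyps by (auto simp: degenerates_def)
    qed
    from hall.span_scale[OF hall.span_diff[OF hall.span_base[OF u(1)] this], of "1 / c"]
    show ?case using c by simp
  qed
  then show "hall_algebra C \<subseteq> hall.span S"
    using in_span_of_singles[of _ S] unfolding hall_algebra_def by blast
qed

text \<open>In a vanishing combination, choose \<open>v\<close> with nonzero coefficient and maximal
  endomorphism number of \<open>l v\<close>. Any other contribution at \<open>l v\<close> would come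
  from some \<open>v'\<close> with \<open>l v = l v'\<close>, against injectivity, or
  \<open>l v \<prec> l v'\<close>, against maximality. So the coefficient at \<open>l v\<close>
  cannot cancel.\<close>

lemma independent_leading_classes:
  assumes lead: "\<And>u. u \<in> S \<Longrightarrow> has_leading_class u (l u)" and "inj_on l S"
  shows "hall.independent S"
proof
  assume "hall.dependent S"
  then obtain T c where T: "finite T" "T \<subseteq> S" "\<exists>v \<in> T. c v \<noteq> 0" "(\<Sum>v \<in> T. hall_scale (c v) v) = 0"
    unfolding hall.dependent_explicit by blast
  let ?T = "{v \<in> T. c v \<noteq> 0}"
  have fin: "finite ?T" "?T \<noteq> {}" using T by auto
  let ?h = "\<lambda>v. hom_number (l v) (l v)"
  have "Max (?h ` ?T) \<in> ?h ` ?T" using fin by simp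
  then obtain v where v: "v \<in> ?T" "?h v = Max (?h ` ?T)" by auto
  have max: "?h v' \<le> ?h v" if "v' \<in> ?T" for v'
    unfolding v(2) using fin that by simp
  have zero: "c v' * Poly_Mapping.lookup v' (l v) = 0" if "v' \<in> T - {v}" for v'
  proof (rule ccontr)
    assume *: "c v' * Poly_Mapping.lookup v' (l v) \<noteq> 0"
    have v': "v' \<in> S" "v \<in> S" "v \<noteq> v'" using that T v by auto
    have "l v \<in> Poly_Mapping.keys v'" using * by (simp add: in_keys_iff)
    then have "l v = l v' \<or> l v \<prec> l v'"
      using lead[OF v'(1)] unfolding has_leading_class_def by blast
    moreover have "l v \<noteq> l v'" using assms(2) v' by (metis inj_onD)
    ultimately show False using max[of v'] * that by (auto simp: degenerates_def)
  qed
  have "0 = (\<Sum>v' \<in> T. c v' * Poly_Mapping.lookup v' (l v))"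
    using arg_cong[OF T(4), of "\<lambda>u. Poly_Mapping.lookup u (l v)"] by (simp add: lookup_sum)
  also have "\<dots> = (\<Sum>v' \<in> {v}. c v' * Poly_Mapping.lookup v' (l v))"
    using T v zero by (intro sum.mono_neutral_right) auto
  finally show False using v lead[of v] T by (auto simp: has_leading_class_def)
qed

end

section \<open>Ordered words\<close>

text \<open>Insertion sort: \<open>x\<close> goes after the letters below it. By totality and
  reflexivity it is below the others, and transitivity orders the two blocks.\<close>

lemma ex_sorted_wrt_mset_eq:
  assumes "linear_order_on A r" "set w \<subseteq> A"
  shows "\<exists>v. mset v = mset w \<and> sorted_wrt (\<lambda>x y. (x, y) \<in> r) v"
  using assms(2)
proof (induction w)
  case (Cons x w)
  have r: "trans r" "total_on A r" "refl_on A r"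
    using assms(1) by (auto simp: linear_order_on_def partial_order_on_def preorder_on_def)
  obtain v where v: "mset v = mset w" "sorted_wrt (\<lambda>x y. (x, y) \<in> r) v" using Cons by auto
  then have "set v \<subseteq> A" using Cons.prems mset_eq_setD[OF v(1)] by auto
  then have "(x, y) \<in> r" if "y \<in> set v" "(y, x) \<notin> r" for y
    using that r Cons.prems by (cases "x = y") (auto simp: total_on_def refl_on_def)
  then have "sorted_wrt (\<lambda>x y. (x, y) \<in> r)
      (filter (\<lambda>y. (y, x) \<in> r) v @ x # filter (\<lambda>y. (y, x) \<notin> r) v)"
    using v(2) r(1) by (auto simp: sorted_wrt_append sorted_wrt_filter dest: transD)
  moreover have "mset (filter (\<lambda>y. (y, x) \<in> r) v @ x # filter (\<lambda>y. (y, x) \<notin> r) v) = mset (x # w)"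
    using v(1) multiset_partition[of "mset v" "\<lambda>y. (y, x) \<in> r"] by simp
  ultimately show ?case by blast
qed simp

text \<open>If the heads differed, each would occur in the tail of the other word, so they would be
  related both ways, against antisymmetry.\<close>

lemma sorted_wrt_mset_unique:
  assumes "antisym r" "sorted_wrt (\<lambda>x y. (x, y) \<in> r) v" "sorted_wrt (\<lambda>x y. (x, y) \<in> r) w"
    and "mset v = mset w"
  shows "v = w"
  using assms(2-)
proof (induction v arbitrary: w)
  case (Cons x v)
  then obtain y w' where w: "w = y # w'" by (cases w) auto
  have eq: "set (x # v) = set (y # w')" using Cons.prems(3) mset_eq_setD w by blast
  have "x = y"
  proof (rule ccontr)
    assume "x \<noteq> y"
    then have "x \<in> set w'" "y \<in> set v" using eq by auto
    then have "(x, y) \<in> r" "(y, x) \<in> r" using Cons.prems(1,2) w by auto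
    then show False using assms(1) \<open>x \<noteq> y\<close> by (auto dest: antisymD)
  qed
  then show ?case using Cons w by auto
qed simp

section \<open>Ordered words and the classes they sum to\<close>

context finitary_exact_category
begin

lemma ordered_words_Iso: "w \<in> ordered_words C r \<Longrightarrow> set w \<subseteq> Iso C"
  using Ind_subset_Iso by (auto simp: ordered_words_def)

lemma ex_ordered_word:
  assumes "linear_order_on (Ind C) r" "P \<in> Iso C"
  shows "\<exists>w \<in> ordered_words C r. class_sum w = P"
proof -
  obtain X where "X \<in> Obj C" "P = iso_class C X" using assms(2) by (rule Iso_cases)
  then obtain w where w: "set w \<subseteq> Ind C" "class_sum w = P" using ex_class_sum_eq by blast
  obtain v where v: "mset v = mset w" "sorted_wrt (\<lambda>x y. (x, y) \<in> r) v"
    using ex_sorted_wrt_mset_eq[OF assms(1) w(1)] by blast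
  have "set v = set w" using v(1) by (rule mset_eq_setD)
  then have "class_sum v = class_sum w"
    using class_sum_finprod[of v] class_sum_finprod[of w] v(1) w(1) Ind_subset_Iso by auto
  then show ?thesis using v w \<open>set v = set w\<close> by (auto simp: ordered_words_def)
qed

text \<open>The Krull-Schmidt property recovers the multiset of letters from the class, and
  sortedness recovers the word from the multiset.\<close>

lemma inj_on_class_sum:
  assumes "Krull_Schmidt C" "antisym r"
  shows "inj_on class_sum (ordered_words C r)"
proof (rule inj_onI)
  fix v w assume vw: "v \<in> ordered_words C r" "w \<in> ordered_words C r" "class_sum v = class_sum w"
  let ?f = "\<lambda>M. \<Otimes>\<^bsub>Iso_monoid C\<^esub> s \<in> set_mset M. s [^]\<^bsub>Iso_monoid C\<^esub> count M s"
  have "inj_on ?f {M. set_mset M \<subseteq> Ind C}"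
    using assms(1) by (auto simp: Krull_Schmidt_def freely_generated_by_def bij_betw_def)
  moreover have "?f (mset v) = ?f (mset w)"
    using vw class_sum_finprod ordered_words_Iso by metis
  moreover have "mset v \<in> {M. set_mset M \<subseteq> Ind C}" "mset w \<in> {M. set_mset M \<subseteq> Ind C}"
    using vw by (auto simp: ordered_words_def)
  ultimately have "mset v = mset w" by (rule inj_onD)
  then show "v = w"
    using vw sorted_wrt_mset_unique[OF assms(2)] by (auto simp: ordered_words_def)
qed

end

theorem theorem2p4:
  fixes C :: "('o, 'm) exact_category_data"
    and r :: "'o set rel"
  assumes "finitary_exact_category C"
    and "linear_order_on (Ind C) r"
  shows "hall.span (hall_monomial C ` ordered_words C r) = hall_algebra C \<and>
    (Krull_Schmidt C \<longrightarrow>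
      inj_on (hall_monomial C) (ordered_words C r) \<and>
      hall.independent (hall_monomial C ` ordered_words C r))"
proof -
  interpret finitary_exact_category C by (rule assms(1))
  let ?W = "ordered_words C r"
  have lead: "has_leading_class (hall_monomial C w) (class_sum w)" if "w \<in> ?W" for w
    using hall_monomial_leading_class ordered_words_Iso that by blast
  have "hall.span (hall_monomial C ` ?W) = hall_algebra C"
  proof (rule span_eq_hall_algebra)
    show "\<exists>u \<in> hall_monomial C ` ?W. has_leading_class u P" if "P \<in> Iso C" for P
      using ex_ordered_word[OF assms(2) that] lead by blast
    show "hall_monomial C ` ?W \<subseteq> hall_algebra C"
      using lead has_leading_class_in_hall_algebra by blast
  qed
  moreover have "inj_on (hall_monomial C) ?W \<and> hall.independent (hall_monomial C ` ?W)"
    if KS: "Krull_Schmidt C"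
  proof
    have "antisym r"
      using assms(2) by (simp add: linear_order_on_def partial_order_on_def)
    with KS have inj_sum: "inj_on class_sum ?W" by (rule inj_on_class_sum)
    \<comment> \<open>Independence of the image set alone would not exclude that two words give the
      same monomial. A monomial determines its leading class, and this determines the word.\<close>
    show inj: "inj_on (hall_monomial C) ?W"
    proof (rule inj_onI)
      fix v w assume "v \<in> ?W" "w \<in> ?W" "hall_monomial C v = hall_monomial C w"
      then show "v = w"
        using lead has_leading_class_unique inj_sum by (metis inj_onD)
    qed
    show "hall.independent (hall_monomial C ` ?W)"
    proof (rule independent_leading_classes)
      \<comment> \<open>Leading classes have to be a function of the monomial rather than of the
        word; injectivity of \<open>hall_monomial C\<close> on \<open>?W\<close> allows reading off
        the word first.\<close>
      let ?l = "\<lambda>u. class_sum (the_inv_into ?W (hall_monomial C) u)"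
      show "has_leading_class u (?l u)" if "u \<in> hall_monomial C ` ?W" for u
        using that lead by (auto simp: the_inv_into_f_f[OF inj])
      show "inj_on ?l (hall_monomial C ` ?W)"
        using inj_sum by (auto simp: inj_on_def the_inv_into_f_f[OF inj])
    qed
  qed
  ultimately show ?thesis by blast
qed

end
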